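(* Let $0<T<\infty$, let $u\in L^p(0,T)$ with $u\ge 0$ and $1<p<\infty$, extended by $0$ outside $[0,T]$, and assume that $\tau_e>0$ on every link $e\in E$. Then there exists a dynamic equilibrium for the inflow rate $u$.
   Context: Network. $G=(V,E)$ is a finite directed graph without loops and with at most one edge from $v$ to $w$ for every pair of nodes; an edge (link) from $v$ to $w$ is written $e=vw$, and $\delta^+(v),\delta^-(v)$ are the sets of edges leaving and entering $v$. Each edge has a service rate $\nu_e>0$ and a travel time $\tau_e$. There are a source $s$ and a sink $t\neq s$; every node is reachable from $s$ by a directed path. $\mathcal F_0(\mathbb R)$ is the set of nonnegative locally integrable functions on $\mathbb R$ that vanish a.e. on $(-\infty,0)$. The inflow rate is $u\in\mathcal F_0(\mathbb R)$. Flows over time. A flow-over-time is a pair $f=(f^+,f^-)$ of arrays of functions $f_e^+,f_e^-\in\mathcal F_0(\mathbb R)$, $e\in E$. Put $F_e^\pm(\theta)=\int_0^\theta f_e^\pm(\xi)\,d\xi$ and $z_e(\theta)=F_e^+(\theta)-F_e^-(\theta+\tau_e)$ (queue size). $f$ is feasible if for almost all $\theta$: $f_e^-(\theta)\le\nu_e$ and $z_e(\theta)\ge0$ for each $e$, and $\sum_{e\in\delta^+(v)}f_e^+(\theta)-\sum_{e\in\delta^-(v)}f_e^-(\theta)$ equals $u(\theta)$ for $v=s$ and $0$ for $v\in V\setminus\{s,t\}$. It is always assumed that queues operate at capacity: for each $e$ and almost all $\theta$, $f_e^-(\theta+\tau_e)=\nu_e$ if $z_e(\theta)>0$ and $f_e^-(\theta+\tau_e)=\min\{f_e^+(\theta),\nu_e\}$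 otherwise. Travel times. $T_e(\theta)=\theta+z_e(\theta)/\nu_e+\tau_e$. For a directed path $P=(e_1,\dots,e_k)$, $\ell^P(\theta)=T_{e_k}\circ\cdots\circ T_{e_1}(\theta)$. The earliest-time functions are $\ell_w(\theta)=\min_{P}\ell^P(\theta)$ over all directed $s$-$w$ paths $P$, with $\ell_s(\theta)=\theta$. An edge $e=vw$ is active at $\theta$ if $T_e(\ell_v(\theta))\le\ell_w(\theta)$ (equivalently, equality holds); $\Theta_e$ is the set of all $\theta\in\mathbb R$ at which $e$ is active. Equilibrium. A feasible flow-over-time $f$ (with queues operating at capacity) is a dynamic equilibrium if for each $e=vw\in E$ we have $f_e^+(\xi)=0$ for almost all $\xi\in\ell_v(\mathbb R\setminus\Theta_e)$. *)

theory Defs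
  imports "HOL-Analysis.Analysis" "Graph_Theory.Pair_Digraph"
begin

text \<open>Arcs of a \<^locale>\<open>pair_digraph\<close> are pairs of nodes, so parallel arcs are excluded by
  construction; finiteness and absence of loops are part of the locale.\<close>

locale fluid_network = pair_digraph G for G :: "'v pair_pre_digraph" +
  fixes \<nu> :: "'v \<times> 'v \<Rightarrow> real" and s t :: 'v
  assumes service_rate_pos: "\<And>e. e \<in> parcs G \<Longrightarrow> 0 < \<nu> e"
    and source_in_verts: "s \<in> pverts G"
    and sink_in_verts: "t \<in> pverts G"
    and source_neq_sink: "t \<noteq> s"
    and all_reachable: "\<And>v. v \<in> pverts G \<Longrightarrow> reachable (with_proj G) s v"

text \<open>Function spaces are represented by functions rather than classes modulo null sets, hence
  nonnegativity is required only almost everywhere. Integrals are taken with respect to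
  \<^term>\<open>lebesgue\<close> (the completed measure), so that Lebesgue measurable functions are allowed.\<close>

definition locally_integrable :: "(real \<Rightarrow> real) \<Rightarrow> bool" where
  "locally_integrable f \<longleftrightarrow> (\<forall>K. compact K \<longrightarrow> set_integrable lebesgue K f)"

definition F0 :: "(real \<Rightarrow> real) set" where
  "F0 = {f. locally_integrable f \<and> (AE x in lebesgue. 0 \<le> f x) \<and>
            (AE x in lebesgue. x < 0 \<longrightarrow> f x = 0)}"

definition Lp_on :: "real \<Rightarrow> real set \<Rightarrow> (real \<Rightarrow> real) set" where
  "Lp_on p S = {f. set_borel_measurable lebesgue S f \<and>
                   set_integrable lebesgue S (\<lambda>x. \<bar>f x\<bar> powr p)}"

text \<open>A flow over time is the pair of the arrays of arc inflow rates and arc outflow rates.\<close>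

type_synonym 'v flow = "('v \<times> 'v \<Rightarrow> real \<Rightarrow> real) \<times> ('v \<times> 'v \<Rightarrow> real \<Rightarrow> real)"

definition flow_over_time :: "'v pair_pre_digraph \<Rightarrow> 'v flow \<Rightarrow> bool" where
  "flow_over_time G f \<longleftrightarrow> (\<forall>e\<in>parcs G. fst f e \<in> F0 \<and> snd f e \<in> F0)"

definition cumulative :: "(real \<Rightarrow> real) \<Rightarrow> real \<Rightarrow> real" where
  "cumulative g \<theta> = (LINT \<xi>=0..\<theta>|lebesgue. g \<xi>)"

definition queue_size :: "('v \<times> 'v \<Rightarrow> real) \<Rightarrow> 'v flow \<Rightarrow> 'v \<times> 'v \<Rightarrow> real \<Rightarrow> real" where
  "queue_size \<tau> f e \<theta> = cumulative (fst f e) \<theta> - cumulative (snd f e) (\<theta> + \<tau> e)"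

definition feasible ::
  "'v pair_pre_digraph \<Rightarrow> ('v \<times> 'v \<Rightarrow> real) \<Rightarrow> ('v \<times> 'v \<Rightarrow> real) \<Rightarrow> 'v \<Rightarrow> 'v
    \<Rightarrow> (real \<Rightarrow> real) \<Rightarrow> 'v flow \<Rightarrow> bool" where
  "feasible G \<nu> \<tau> s t u f \<longleftrightarrow> flow_over_time G f \<and>
     (AE \<theta> in lebesgue.
        (\<forall>e\<in>parcs G. snd f e \<theta> \<le> \<nu> e \<and> 0 \<le> queue_size \<tau> f e \<theta>) \<and>
        (\<forall>v\<in>pverts G - {t}.
           (\<Sum>e\<in>out_arcs (with_proj G) v. fst f e \<theta>) - (\<Sum>e\<in>in_arcs (with_proj G) v. snd f e \<theta>)
             = (if v = s then u \<theta> else 0)))"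

definition operates_at_capacity ::
  "'v pair_pre_digraph \<Rightarrow> ('v \<times> 'v \<Rightarrow> real) \<Rightarrow> ('v \<times> 'v \<Rightarrow> real) \<Rightarrow> 'v flow \<Rightarrow> bool" where
  "operates_at_capacity G \<nu> \<tau> f \<longleftrightarrow>
     (\<forall>e\<in>parcs G. AE \<theta> in lebesgue.
        snd f e (\<theta> + \<tau> e) =
          (if 0 < queue_size \<tau> f e \<theta> then \<nu> e else min (fst f e \<theta>) (\<nu> e)))"

definition exit_time ::
  "('v \<times> 'v \<Rightarrow> real) \<Rightarrow> ('v \<times> 'v \<Rightarrow> real) \<Rightarrow> 'v flow \<Rightarrow> 'v \<times> 'v \<Rightarrow> real \<Rightarrow> real" where
  "exit_time \<nu> \<tau> f e \<theta> = \<theta> + queue_size \<tau> f e \<theta> / \<nu> e + \<tau> e"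

text \<open>The first arc of the path is applied first.\<close>

definition path_exit_time ::
  "('v \<times> 'v \<Rightarrow> real) \<Rightarrow> ('v \<times> 'v \<Rightarrow> real) \<Rightarrow> 'v flow \<Rightarrow> ('v \<times> 'v) list \<Rightarrow> real \<Rightarrow> real" where
  "path_exit_time \<nu> \<tau> f P = fold (exit_time \<nu> \<tau> f) P"

text \<open>Paths do not repeat nodes, so there are finitely many of them, and the empty path is the only
  path from the source to itself.\<close>

definition earliest_time ::
  "'v pair_pre_digraph \<Rightarrow> ('v \<times> 'v \<Rightarrow> real) \<Rightarrow> ('v \<times> 'v \<Rightarrow> real) \<Rightarrow> 'v
    \<Rightarrow> 'v flow \<Rightarrow> 'v \<Rightarrow> real \<Rightarrow> real" where
  "earliest_time G \<nu> \<tau> s f w \<theta> =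
     Min {path_exit_time \<nu> \<tau> f P \<theta> | P. pre_digraph.apath (with_proj G) s P w}"

definition active_times ::
  "'v pair_pre_digraph \<Rightarrow> ('v \<times> 'v \<Rightarrow> real) \<Rightarrow> ('v \<times> 'v \<Rightarrow> real) \<Rightarrow> 'v
    \<Rightarrow> 'v flow \<Rightarrow> 'v \<times> 'v \<Rightarrow> real set" where
  "active_times G \<nu> \<tau> s f e =
     {\<theta>. exit_time \<nu> \<tau> f e (earliest_time G \<nu> \<tau> s f (fst e) \<theta>)
            \<le> earliest_time G \<nu> \<tau> s f (snd e) \<theta>}"

definition dynamic_equilibrium ::
  "'v pair_pre_digraph \<Rightarrow> ('v \<times> 'v \<Rightarrow> real) \<Rightarrow> ('v \<times> 'v \<Rightarrow> real) \<Rightarrow> 'v \<Rightarrow> 'v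
    \<Rightarrow> (real \<Rightarrow> real) \<Rightarrow> 'v flow \<Rightarrow> bool" where
  "dynamic_equilibrium G \<nu> \<tau> s t u f \<longleftrightarrow>
     feasible G \<nu> \<tau> s t u f \<and> operates_at_capacity G \<nu> \<tau> f \<and>
     (\<forall>e\<in>parcs G. AE \<xi> in lebesgue.
        \<xi> \<in> earliest_time G \<nu> \<tau> s f (fst e) ` (UNIV - active_times G \<nu> \<tau> s f e)
          \<longrightarrow> fst f e \<xi> = 0)"

lemma (in fluid_network) finite_nonempty_path_exit_times:
  assumes "w \<in> pverts G"
  shows "finite {path_exit_time \<nu> \<tau> f P \<theta> | P. apath s P w}"
    and "{path_exit_time \<nu> \<tau> f P \<theta> | P. apath s P w} \<noteq> {}"
proof -
  have "{path_exit_time \<nu> \<tau> f P \<theta> | P. apath s P w}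
      = (\<lambda>P. path_exit_time \<nu> \<tau> f P \<theta>) ` {P. apath s P w}"
    by auto
  then show "finite {path_exit_time \<nu> \<tau> f P \<theta> | P. apath s P w}"
    using apaths_finite[of s w] by simp
  show "{path_exit_time \<nu> \<tau> f P \<theta> | P. apath s P w} \<noteq> {}"
    using all_reachable[OF assms] reachable_apath by auto
qed

lemma (in fluid_network) earliest_time_source: "earliest_time G \<nu> \<tau> s f s \<theta> = \<theta>"
proof -
  have "apath s P s \<longleftrightarrow> P = []" for P
    using source_in_verts apath_nonempty_ends by (auto simp: apath_Nil_iff)
  then show ?thesis
    by (simp add: earliest_time_def path_exit_time_def)
qed

end

(*
  Everything is parametrised by the departure time \<theta> from the source, with unknowns l v (earliest
  arrival at v), q e (exit time from e after entering it at l (fst e)) and x e (flow that has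
  entered e by then). In these variables an equilibrium is a purely order-theoretic system: q e is
  the latest of "no queue" and "queue served at rate \<nu> e", l is the Bellman labelling for the exit
  times q, and x e grows only while e is tight.

  An explicit Euler scheme, which sends the inflow of every time step along one tight s-t path,
  solves the system up to the step size. All its functions are nondecreasing with increments
  dominated by those of one fixed continuous function, so by Tychonoff's theorem the approximations
  converge pointwise along some filter, and the limit solves the system exactly.

  Conversely, an exact solution yields the cumulative in- and outflow of e = vw by inverting l v and
  l w. These are dominated by absolutely continuous functions, so they have densities by the
  Radon-Nikodym theorem, and these densities form the equilibrium.
*)
theory Submission
  imports Defs
begin

text \<open>Flow rates are derivatives and behave badly under pointwise limits, so every condition
  is first stated without them: as a weak inequality or equation between values at given departure
  times, or as the existence of a point or arc satisfying one. Such conditions survive the limit.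
  Positive travel times make the Bellman system rigid: a tight arc strictly raises the label, so
  labels can be proved unique, monotone and of bounded growth by comparison with subsolutions. The
  labels may have plateaus and need not be injective in the departure time. Inverting them is
  harmless because \<open>x e\<close> is Lipschitz with respect to the label at the head of
  \<open>e\<close> and, unless the tail is the source, the label at the tail, hence constant on
  plateaus. The same Lipschitz bounds dominate the cumulative flows. The delicate almost-everywhere
  statement is that outflow equals inflow while the queue is empty: the set of such times need not
  contain an interval. It is settled by pushing a measure forward, without differentiating
  anything.\<close>

section \<open>Densities of monotone functions\<close>

text \<open>\<open>F\<close> is locally absolutely continuous and nondecreasing, and
  \<open>f\<close> fixes it up to a constant. Borel measurability and nonnegativity everywhere let
  \<open>f\<close> serve directly as the density of a Borel measure.\<close>

definition has_density :: "(real \<Rightarrow> real) \<Rightarrow> (real \<Rightarrow> real) \<Rightarrow> bool" where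
  "has_density F f \<longleftrightarrow> f \<in> borel_measurable borel \<and> (\<forall>x. 0 \<le> f x) \<and>
     (\<forall>a b. a \<le> b \<longrightarrow> (f has_integral (F b - F a)) {a..b})"

lemma has_densityD:
  assumes "has_density F f"
  shows "f \<in> borel_measurable borel" "0 \<le> f x"
    and "a \<le> b \<Longrightarrow> (f has_integral (F b - F a)) {a..b}"
  using assms by (auto simp: has_density_def)

lemma has_density_mono: "has_density F f \<Longrightarrow> mono F"
  using has_densityD(2,3) has_integral_nonneg by (metis diff_ge_0_iff_ge monoI)

lemma has_density_add:
  "has_density F f \<Longrightarrow> has_density G g \<Longrightarrow> has_density (\<lambda>x. F x + G x) (\<lambda>x. f x + g x)"
  unfolding has_density_def by (auto simp: add_diff_add intro!: has_integral_add)

lemma has_density_cmult: "0 \<le> c \<Longrightarrow> has_density (\<lambda>x. c * x) (\<lambda>x. c)"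
proof -
  assume "0 \<le> c"
  moreover have "((\<lambda>x. c) has_integral (c * b - c * a)) {a..b}" if "a \<le> b" for a b
    using has_integral_const_real[of c a b] that by (simp add: algebra_simps)
  ultimately show ?thesis by (simp add: has_density_def)
qed

lemma has_density_scale:
  assumes "has_density F f" "0 \<le> c"
  shows "has_density (\<lambda>x. c * F x) (\<lambda>x. c * f x)"
  unfolding has_density_def
proof (intro conjI allI impI)
  show "(\<lambda>x. c * f x) \<in> borel_measurable borel" "0 \<le> c * f x" for x
    using has_densityD(1,2)[OF assms(1)] assms(2) by auto
  fix a b :: real assume "a \<le> b"
  from has_integral_mult_right[OF has_densityD(3)[OF assms(1) this], of c]
  show "((\<lambda>x. c * f x) has_integral (c * F b - c * F a)) {a..b}"
    by (simp add: right_diff_distrib)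
qed

lemma has_density_sum:
  assumes "finite I" "\<And>i. i \<in> I \<Longrightarrow> has_density (F i) (f i)"
  shows "has_density (\<lambda>x. \<Sum>i\<in>I. F i x) (\<lambda>x. \<Sum>i\<in>I. f i x)"
  using assms
proof (induction rule: finite_induct)
  case empty
  show ?case using has_density_cmult[of 0] by simp
next
  case (insert i I)
  then show ?case using has_density_add[of "F i" "f i"] by simp
qed

lemma has_density_shift:
  assumes "has_density F f"
  shows "has_density (\<lambda>x. F (x + c)) (\<lambda>x. f (x + c))"
proof -
  have "((\<lambda>x. f (x + c)) has_integral (F (b + c) - F (a + c))) {a..b}" if "a \<le> b" for a b
    using has_integral_affinity[OF has_densityD(3)[OF assms, of "a + c" "b + c", unfolded interval_cbox], of 1 c] that
    by simp
  then show ?thesis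
    using has_densityD(1,2)[OF assms] by (simp add: has_density_def)
qed

lemma has_density_continuous:
  assumes "has_density F f"
  shows "isCont F x"
proof -
  have *: "F y = F (x - 1) + integral {x - 1..y} f" if "y \<in> {x - 1..x + 1}" for y
    using has_densityD(3)[OF assms, of "x - 1" y] that by (auto simp: integral_unique)
  have "f integrable_on {x - 1..x + 1}"
    using has_densityD(3)[OF assms, of "x - 1" "x + 1"] by auto
  then have "continuous_on {x - 1..x + 1} (\<lambda>y. F (x - 1) + integral {x - 1..y} f)"
    by (intro continuous_intros indefinite_integral_continuous_1)
  then have "continuous_on {x - 1..x + 1} F"
    using * continuous_on_eq[of _ "\<lambda>y. F (x - 1) + integral {x - 1..y} f" F] by metis
  then show ?thesis
    by (rule continuous_on_interior) simp
qed

lemma isCont_dominated_increments: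
  fixes F G :: "real \<Rightarrow> real"
  assumes mono: "\<And>a b. a \<le> b \<Longrightarrow> F a \<le> F b"
    and le: "\<And>a b. a \<le> b \<Longrightarrow> F b - F a \<le> G b - G a"
    and G: "isCont G x"
  shows "isCont F x"
proof -
  have "((\<lambda>y. \<bar>G y - G x\<bar>) \<longlongrightarrow> 0) (at x)"
    using G by (simp add: isCont_def LIM_zero tendsto_rabs_zero)
  moreover have "\<bar>F y - F x\<bar> \<le> \<bar>G y - G x\<bar>" for y
    using le[of x y] le[of y x] mono[of x y] mono[of y x] by linarith
  ultimately have "((\<lambda>y. F y - F x) \<longlongrightarrow> 0) (at x)"
    by (intro Lim_null_comparison[of "\<lambda>y. F y - F x"]) auto
  then show ?thesis
    by (simp add: isCont_def LIM_zero_iff)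
qed

section \<open>Existence, uniqueness and comparison of densities via Borel measures\<close>

lemma emeasure_density_Ioc:
  assumes "has_density F f" "a \<le> b"
  shows "emeasure (density lborel f) {a<..b} = ennreal (F b - F a)"
proof -
  have "(f has_integral (F b - F a)) {a<..b}"
    using has_densityD(3)[OF assms]
    by (subst has_integral_spike_set_eq[of "{a<..b}" "{a..b}"])
       (auto intro: negligible_subset[of "{a}"])
  then have "((\<lambda>x. if x \<in> {a<..b} then f x else 0) has_integral (F b - F a)) UNIV"
    by (simp only: has_integral_restrict_UNIV)
  then have "(\<integral>\<^sup>+x. ennreal (if x \<in> {a<..b} then f x else 0) \<partial>lborel) = ennreal (F b - F a)"
    using has_densityD(1,2)[OF assms(1)]
    by (intro nn_integral_has_integral_lborel) auto
  moreover have "emeasure (density lborel f) {a<..b} = (\<integral>\<^sup>+x. ennreal (if x \<in> {a<..b} then f x else 0) \<partial>lborel)"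
    using has_densityD(1)[OF assms(1)]
    by (auto simp: emeasure_density intro!: nn_integral_cong split: split_indicator)
  ultimately show ?thesis by simp
qed

text \<open>Half-open intervals form an intersection-stable generator of the Borel sets, and
  countably many of them, of finite measure, exhaust the line.\<close>

lemma borel_measure_eqI_Ioc:
  fixes M N :: "real measure"
  assumes "sets M = sets borel" "sets N = sets borel"
    and fin: "\<And>a b. a \<le> b \<Longrightarrow> emeasure M {a<..b} < \<infinity>"
    and eq: "\<And>a b. a \<le> b \<Longrightarrow> emeasure M {a<..b} = emeasure N {a<..b}"
  shows "M = N"
proof (rule measure_eqI_generator_eq_countable)
  let ?E = "range (\<lambda>(a, b). {a<..b::real})"
  show "Int_stable ?E"
  proof -
    have "{a<..b} \<inter> {c<..d} \<in> ?E" for a b c d :: real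
      by (rule image_eqI[of _ _ "(max a c, min b d)"]) auto
    then show ?thesis by (auto simp: Int_stable_def)
  qed
  show "?E \<subseteq> Pow UNIV" "sets M = sigma_sets UNIV ?E" "sets N = sigma_sets UNIV ?E"
    by (simp_all add: assms(1,2) borel_sigma_sets_Ioc)
  show "(\<lambda>n. {- real n<..real n}) ` UNIV \<subseteq> ?E" by auto
  show "(\<Union>((\<lambda>n. {- real n<..real n}) ` UNIV)) = UNIV"
  proof -
    have "\<exists>n. x \<in> {- real n<..real n}" for x
    proof -
      obtain n where "\<bar>x\<bar> < real n" using reals_Archimedean2 by blast
      then have "x \<in> {- real n<..real n}" by auto
      then show ?thesis ..
    qed
    then show ?thesis by auto
  qed
  show "countable ((\<lambda>n. {- real n<..real n}) ` (UNIV::nat set))" by simp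
  show "emeasure M A \<noteq> \<infinity>" if "A \<in> (\<lambda>n. {- real n<..real n}) ` (UNIV::nat set)" for A
  proof -
    from that obtain n where "A = {- real n<..real n}" by blast
    then show ?thesis using fin[of "- real n" "real n"] by simp
  qed
  show "emeasure M X = emeasure N X" if "X \<in> ?E" for X
  proof -
    obtain a b where X: "X = {a<..b}" using \<open>X \<in> ?E\<close> by auto
    show ?thesis
      using eq[of a b] by (cases "a \<le> b") (auto simp: X)
  qed
qed


text \<open>The difference \<open>G - F\<close> is again nondecreasing, so the measure with density
  \<open>g\<close> is the sum of the Stieltjes measures of \<open>F\<close> and
  \<open>G - F\<close>. A Lebesgue null set is null for the sum, hence for the first summand, and
  the Radon-Nikodym theorem applies.\<close>

lemma mono_density_exists:
  fixes F G :: "real \<Rightarrow> real"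
  assumes G: "has_density G g" and F: "mono F"
    and le: "\<And>a b. a \<le> b \<Longrightarrow> F b - F a \<le> G b - G a"
  obtains f where "has_density F f"
proof -
  define H where "H x = G x - F x" for x
  have H: "mono H"
    using le by (auto simp: mono_def H_def algebra_simps)
  have contF: "isCont F x" for x
    using isCont_dominated_increments[of F G x] has_density_continuous[OF G] monoD[OF F] le by blast
  have cF: "continuous (at_right x) F" and cH: "continuous (at_right x) H" for x
    using contF[of x] has_density_continuous[OF G, of x]
    by (auto simp: H_def[abs_def] continuous_at_imp_continuous_within intro!: continuous_diff)
  let ?MF = "interval_measure F" and ?MH = "interval_measure H"
  define N where "N = measure_of UNIV (sets borel) (\<lambda>A. emeasure ?MF A + emeasure ?MH A)"
  have emN: "emeasure N A = emeasure ?MF A + emeasure ?MH A" if "A \<in> sets borel" for A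
    unfolding N_def
  proof (rule emeasure_measure_of_sigma)
    show "sigma_algebra UNIV (sets (borel :: real measure))"
      using sets.sigma_algebra_axioms[of "borel :: real measure"] by simp
    show "positive (sets borel) (\<lambda>A. emeasure ?MF A + emeasure ?MH A)"
      by (simp add: positive_def)
    show "countably_additive (sets borel) (\<lambda>A. emeasure ?MF A + emeasure ?MH A)"
    proof (rule countably_additiveI)
      fix A :: "nat \<Rightarrow> real set" assume A: "range A \<subseteq> sets borel" "disjoint_family A"
      then show "(\<Sum>i. emeasure ?MF (A i) + emeasure ?MH (A i))
          = emeasure ?MF (\<Union>(range A)) + emeasure ?MH (\<Union>(range A))"
        by (subst suminf_add[symmetric]) (auto intro!: arg_cong2[where f="(+)"] suminf_emeasure)
    qed
  qed (use that in auto)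
  have "density lborel g = N"
  proof (rule borel_measure_eqI_Ioc)
    show "sets N = sets borel"
      by (simp add: N_def sets.sigma_sets_eq[of borel, simplified])
    show "emeasure (density lborel g) {a<..b} < \<infinity>" if "a \<le> b" for a b
      using emeasure_density_Ioc[OF G that] by simp
    show "emeasure (density lborel g) {a<..b} = emeasure N {a<..b}" if "a \<le> b" for a b
      using monoD[OF F that] monoD[OF H that] monoD[OF F] monoD[OF H] that cF cH
      by (simp add: emeasure_density_Ioc[OF G] emN emeasure_interval_measure_Ioc H_def
          flip: ennreal_plus)
  qed simp
  have "absolutely_continuous lborel ?MF"
    unfolding absolutely_continuous_def
  proof
    fix A :: "real set" assume A: "A \<in> null_sets lborel"
    then have "emeasure (density lborel g) A = 0"
      using has_densityD(1)[OF G] by (subst emeasure_density) (auto simp: nn_integral_null_set)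
    then show "A \<in> null_sets ?MF"
      using A \<open>density lborel g = N\<close> emN[of A] by (auto simp: null_sets_def)
  qed
  then obtain f' where f': "f' \<in> borel_measurable lborel" "density lborel f' = ?MF"
    using sigma_finite_measure.Radon_Nikodym[OF sigma_finite_lborel, of ?MF] by auto
  \<comment> \<open>Stieltjes measures are sigma-finite, so the extended real density is finite
    almost everywhere and a real version of it exists.\<close>
  have fin: "AE x in lborel. f' x \<noteq> \<infinity>"
    using sigma_finite_measure.sigma_finite_iff_density_finite[OF sigma_finite_lborel f'(1)] f'(2)
      sigma_finite_interval_measure[of F] monoD[OF F] cF by auto
  define f where "f x = enn2real (f' x)" for x
  have fm [measurable]: "f \<in> borel_measurable borel"
    using f'(1) unfolding f_def by simp
  have ff': "AE x in lborel. f' x = ennreal (f x)"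
    using fin by eventually_elim (simp add: f_def less_top)
  have "(f has_integral (F b - F a)) {a..b}" if ab: "a \<le> b" for a b
  proof -
    have "(\<integral>\<^sup>+x. ennreal (f x * indicator {a..b} x) \<partial>lborel) = (\<integral>\<^sup>+x. f' x * indicator {a..b} x \<partial>lborel)"
      using ff' by (intro nn_integral_cong_AE) (auto split: split_indicator)
    also have "\<dots> = emeasure (density lborel f') {a..b}"
      using f'(1) by (simp add: emeasure_density)
    also have "\<dots> = ennreal (F b - F a)"
      unfolding f'(2) 
    proof (rule emeasure_interval_measure_Icc[OF ab monoD[OF F]])
      show "continuous_on UNIV F"
        using contF by (simp add: continuous_at_imp_continuous_on)
    qed
    finally have "((\<lambda>x. f x * indicator {a..b} x) has_integral (F b - F a)) UNIV"
      using monoD[OF F ab]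
      by (intro nn_integral_has_integral) (auto simp: f_def[symmetric], simp add: f_def)
    moreover have "(\<lambda>x. f x * indicator {a..b} x) = (\<lambda>x. if x \<in> {a..b} then f x else 0)"
      by auto
    ultimately show ?thesis
      by (simp only: has_integral_restrict_UNIV)
  qed
  then have "has_density F f"
    by (simp add: has_density_def f_def)
  then show ?thesis ..
qed

lemma density_AE_unique:
  assumes f: "has_density F f" and g: "has_density G g"
    and eq: "\<And>a b. a \<le> b \<Longrightarrow> F b - F a = G b - G a"
  shows "AE x in lborel. f x = g x"
proof -
  have "density lborel f = density lborel g"
  proof (rule borel_measure_eqI_Ioc)
    show "emeasure (density lborel f) {a<..b} < \<infinity>" if "a \<le> b" for a b
      using emeasure_density_Ioc[OF f that] by simp
    show "emeasure (density lborel f) {a<..b} = emeasure (density lborel g) {a<..b}" if "a \<le> b" for a b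
      using emeasure_density_Ioc[OF f that] emeasure_density_Ioc[OF g that] eq[OF that] by simp
  qed simp_all
  then have "AE x in lborel. ennreal (f x) = ennreal (g x)"
    using has_densityD(1)[OF f] has_densityD(1)[OF g]
    by (subst sigma_finite_measure.density_unique_iff[OF sigma_finite_lborel, symmetric]) auto
  then show ?thesis
    by eventually_elim (use has_densityD(2)[OF f] has_densityD(2)[OF g] in simp)
qed

text \<open>The nondecreasing difference \<open>G - F\<close> has a density \<open>h\<close> of its
  own, and uniqueness gives \<open>g = f + h\<close> almost everywhere.\<close>

lemma density_AE_le:
  assumes f: "has_density F f" and g: "has_density G g"
    and le: "\<And>a b. a \<le> b \<Longrightarrow> F b - F a \<le> G b - G a"
  shows "AE x in lborel. f x \<le> g x"
proof -
  obtain h where h: "has_density (\<lambda>x. G x - F x) h"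
  proof (rule mono_density_exists[OF g])
    show "mono (\<lambda>x. G x - F x)"
      using le by (auto simp: mono_def algebra_simps)
  qed (use monoD[OF has_density_mono[OF f]] in auto)
  have "AE x in lborel. f x + h x = g x"
    using density_AE_unique[OF has_density_add[OF f h] g] by simp
  then show ?thesis
    by eventually_elim (metis add_increasing2 has_densityD(2)[OF h] order_refl)
qed

text \<open>Freezing \<open>F\<close> outside \<open>{c..d}\<close> turns a comparison of increments
  inside this interval into one on the whole line; this localises the two results above.\<close>

lemma has_density_clip:
  assumes f: "has_density F f" and cd: "c \<le> d"
  shows "has_density (\<lambda>x. F (max c (min d x))) (\<lambda>x. if x \<in> {c..d} then f x else 0)"
  unfolding has_density_def
proof (intro conjI allI impI)
  show "(\<lambda>x. if x \<in> {c..d} then f x else 0) \<in> borel_measurable borel"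
    using has_densityD(1)[OF f] by measurable
  show "0 \<le> (if x \<in> {c..d} then f x else 0)" for x
    using has_densityD(2)[OF f] by simp
  fix a b :: real assume ab: "a \<le> b"
  have Int: "{c..d} \<inter> {a..b} = {max c a..min d b}" by auto
  have "(f has_integral (F (max c (min d b)) - F (max c (min d a)))) {max c a..min d b}"
  proof (cases "max c a \<le> min d b")
    case True
    then have "max c (min d b) = min d b" "max c (min d a) = max c a"
      using ab cd by auto
    then show ?thesis using has_densityD(3)[OF f True] by simp
  next
    case False
    then have "max c (min d b) = max c (min d a)" and "{max c a..min d b} = {}"
      using ab cd by auto
    then show ?thesis by simp
  qed
  then show "((\<lambda>x. if x \<in> {c..d} then f x else 0) has_integral
      (F (max c (min d b)) - F (max c (min d a)))) {a..b}"
    by (simp only: has_integral_restrict_Int Int)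
qed

lemma density_AE_le_on:
  assumes f: "has_density F f" and g: "has_density G g"
    and le: "\<And>a b. c \<le> a \<Longrightarrow> a \<le> b \<Longrightarrow> b \<le> d \<Longrightarrow> F b - F a \<le> G b - G a"
  shows "AE x in lborel. c \<le> x \<and> x \<le> d \<longrightarrow> f x \<le> g x"
proof (cases "c \<le> d")
  case True
  have "AE x in lborel. (if x \<in> {c..d} then f x else 0) \<le> (if x \<in> {c..d} then g x else 0)"
    by (rule density_AE_le[OF has_density_clip[OF f True] has_density_clip[OF g True] le]) (use True in auto)
  then show ?thesis
    by eventually_elim (auto split: if_splits)
qed auto

lemma density_AE_eq_on:
  assumes f: "has_density F f" and g: "has_density G g"
    and eq: "\<And>a b. c \<le> a \<Longrightarrow> a \<le> b \<Longrightarrow> b \<le> d \<Longrightarrow> F b - F a = G b - G a"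
  shows "AE x in lborel. c \<le> x \<and> x \<le> d \<longrightarrow> f x = g x"
proof -
  have "AE x in lborel. c \<le> x \<and> x \<le> d \<longrightarrow> f x \<le> g x"
    by (rule density_AE_le_on[OF f g]) (simp add: eq)
  moreover have "AE x in lborel. c \<le> x \<and> x \<le> d \<longrightarrow> g x \<le> f x"
    by (rule density_AE_le_on[OF g f]) (simp add: eq)
  ultimately show ?thesis
    by eventually_elim auto
qed

text \<open>The image of the measure \<^term>\<open>density lborel d\<close> under its own distribution function
  \<^term>\<open>D\<close> is Lebesgue measure. Up to countably many level sets, \<^term>\<open>D\<close> maps no point
  from outside into its fixed point set, so the two measures agree on that set.\<close>

lemma density_one_on_fixed_points:
  assumes D: "has_density D d" and ge: "\<And>x. x \<le> D x" and id: "\<And>x. x \<le> c \<Longrightarrow> D x = x"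
  shows "AE x in lborel. D x = x \<longrightarrow> d x = 1"
proof -
  note mono = monoD[OF has_density_mono[OF D]]
  have cont: "continuous_on A D" for A
    using has_density_continuous[OF D] by (simp add: continuous_at_imp_continuous_on)
  have [measurable]: "D \<in> borel_measurable borel" "d \<in> borel_measurable borel"
    using cont has_densityD(1)[OF D] by (auto intro: borel_measurable_continuous_onI)
  \<comment> \<open>\<open>y\<close> is the last point of the level set \<open>D = a\<close>. With
    it, the preimage of a half-open interval under \<open>D\<close> is half-open, and its mass is
    the length of the original interval.\<close>
  have "\<exists>y. D y = a \<and> (\<forall>x. D x \<le> a \<longleftrightarrow> x \<le> y)" for a
  proof -
    let ?S = "{x. D x \<le> a}"
    have "closed ?S"
      using cont by (intro closed_Collect_le) auto
    moreover have bdd: "bdd_above ?S"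
      using ge by (intro bdd_aboveI[of _ a]) (auto intro: order_trans)
    moreover have ne: "min c a \<in> ?S"
      using id[of "min c a"] by simp
    ultimately have S: "Sup ?S \<in> ?S"
      using closed_contains_Sup[of ?S] by (metis empty_iff)
    have "\<exists>y\<ge>min c a. y \<le> a \<and> D y = a"
      using ne ge[of a] cont by (intro IVT') auto
    then obtain y where y: "D y = a" by blast
    then have "y \<le> Sup ?S"
      by (intro cSup_upper bdd) auto
    then have "D (Sup ?S) = a"
      using mono[of y "Sup ?S"] y S by auto
    moreover have "D x \<le> a \<longleftrightarrow> x \<le> Sup ?S" for x
      using S mono[of x "Sup ?S"] cSup_upper[OF _ bdd, of x] by auto
    ultimately show ?thesis by blast
  qed
  then obtain Y where Y: "\<And>a. D (Y a) = a" "\<And>a x. D x \<le> a \<longleftrightarrow> x \<le> Y a"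
    by metis
  let ?M = "density lborel d"
  have distr: "distr ?M borel D = lborel"
  proof (rule borel_measure_eqI_Ioc)
    fix a b :: real assume ab: "a \<le> b"
    have "D -` {a<..b} = {Y a<..Y b}"
      using Y(2) by (auto simp: not_le[symmetric])
    moreover have "Y a \<le> Y b"
      using Y ab by metis
    ultimately show eq: "emeasure (distr ?M borel D) {a<..b} = emeasure lborel {a<..b}"
      using ab by (simp add: emeasure_distr emeasure_density_Ioc[OF D] Y(1))
    then show "emeasure (distr ?M borel D) {a<..b} < \<infinity>"
      using ab by simp
  qed simp_all
  have em: "emeasure ?M (D -` B) = emeasure lborel B" if "B \<in> sets borel" for B
    using arg_cong[OF distr, of "\<lambda>M. emeasure M B"] that by (simp add: emeasure_distr)
  let ?Z = "{x. D x = x}"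
  have Z [measurable]: "?Z \<in> sets borel"
    using cont by (intro borel_closed closed_Collect_eq) auto
  have count: "countable (D ` \<rat>)"
    by (intro countable_image countable_rat)
  have eqB: "emeasure ?M B = emeasure lborel B" if B [measurable]: "B \<in> sets borel" and "B \<subseteq> ?Z" for B
  proof (rule antisym)
    have [measurable]: "D -` B \<in> sets borel"
      using measurable_sets[of D borel borel B] by simp
    have mC [measurable]: "D ` \<rat> \<in> sets borel"
      using count by (rule sets.countable[rotated]) auto
    have [measurable]: "D -` (D ` \<rat>) \<in> sets borel"
      using measurable_sets[of D borel borel "D ` \<rat>"] by simp
    have "emeasure ?M B \<le> emeasure ?M (D -` B)"
      using \<open>B \<subseteq> ?Z\<close> by (intro emeasure_mono) auto
    then show "emeasure ?M B \<le> emeasure lborel B"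
      by (simp add: em)
    \<comment> \<open>If \<open>D\<close> moves \<open>y\<close> up to a fixed point
      \<open>D y\<close>, monotonicity makes it constant from \<open>y\<close> to
      \<open>D y\<close>, so the same value is attained at a rational. The values at rationals are
      countably many, and their preimage has mass zero.\<close>
    have "D -` B \<subseteq> B \<union> D -` (D ` \<rat>)"
    proof
      fix y assume y: "y \<in> D -` B"
      show "y \<in> B \<union> D -` (D ` \<rat>)"
      proof (cases "y = D y")
        case False
        then have "y < D y" using ge[of y] by simp
        then obtain r where r: "r \<in> \<rat>" "y < r" "r < D y"
          using Rats_dense_in_real by blast
        have "D (D y) = D y" using y \<open>B \<subseteq> ?Z\<close> by auto
        then have "D r = D y" using mono[of y r] mono[of r "D y"] r by simp
        then show ?thesis using r(1) by (auto intro!: image_eqI[of _ _ r])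
      qed (use y in auto)
    qed
    then have "emeasure ?M (D -` B) \<le> emeasure ?M (B \<union> D -` (D ` \<rat>))"
      by (intro emeasure_mono) auto
    also have "\<dots> \<le> emeasure ?M B + emeasure ?M (D -` (D ` \<rat>))"
      by (intro emeasure_subadditive) auto
    also have "emeasure ?M (D -` (D ` \<rat>)) = 0"
      using count by (simp add: em emeasure_lborel_countable)
    finally show "emeasure lborel B \<le> emeasure ?M B"
      by (simp add: em)
  qed
  have "density lborel (\<lambda>x. ennreal (d x) * indicator ?Z x) = density lborel (indicator ?Z)"
  proof (rule measure_eqI)
    fix A assume "A \<in> sets (density lborel (\<lambda>x. ennreal (d x) * indicator ?Z x))"
    then have A [measurable]: "A \<in> sets borel" by simp
    have "emeasure (density lborel (\<lambda>x. ennreal (d x) * indicator ?Z x)) A = emeasure ?M (A \<inter> ?Z)"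
      by (simp add: emeasure_density indicator_inter_arith ac_simps)
    also have "\<dots> = emeasure (density lborel (indicator ?Z)) A"
    proof -
      have "emeasure ?M (A \<inter> ?Z) = emeasure lborel (A \<inter> ?Z)"
        by (rule eqB) auto
      moreover have "emeasure (density lborel (indicator ?Z)) A = emeasure lborel (A \<inter> ?Z)"
        by (simp add: emeasure_density indicator_inter_arith[symmetric] Int_commute)
      ultimately show ?thesis by simp
    qed
    finally show "emeasure (density lborel (\<lambda>x. ennreal (d x) * indicator ?Z x)) A
        = emeasure (density lborel (indicator ?Z)) A" .
  qed simp
  then have "AE x in lborel. ennreal (d x) * indicator ?Z x = indicator ?Z x"
    by (subst sigma_finite_measure.density_unique_iff[OF sigma_finite_lborel, symmetric]) auto
  then show ?thesis
    by eventually_elim (auto simp: ennreal_eq_1)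
qed

section \<open>Bellman labels\<close>

context fluid_network
begin

text \<open>The Bellman equations as inequalities. The source has its label prescribed and is exempt
  from having a tight incoming arc; values outside the node set are left free.\<close>

definition label_solution :: "('v \<times> 'v \<Rightarrow> real \<Rightarrow> real) \<Rightarrow> real \<Rightarrow> ('v \<Rightarrow> real) \<Rightarrow> bool" where
  "label_solution T \<theta> L \<longleftrightarrow> L s = \<theta> \<and> (\<forall>e\<in>parcs G. L (snd e) \<le> T e (L (fst e))) \<and>
     (\<forall>w\<in>pverts G - {s}. \<exists>e\<in>parcs G. snd e = w \<and> T e (L (fst e)) \<le> L w)"

lemma arc_ends_in_verts: "e \<in> parcs G \<Longrightarrow> fst e \<in> pverts G \<and> snd e \<in> pverts G"
  by (metis in_arcsD1 in_arcsD2 prod.collapse)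

lemma awalk_verts_snoc:
  "awalk u P (fst e) \<Longrightarrow> awalk_verts u (P @ [e]) = awalk_verts u P @ [snd e]"
  by (induction P arbitrary: u) (auto simp: awalk_Cons_iff awalk_Nil_iff)

lemma awlast_eq: "awalk u P v \<Longrightarrow> awlast u P = v"
  by auto

lemma apath_snoc_iff:
  "apath u (P @ [e]) w \<longleftrightarrow>
     e \<in> parcs G \<and> snd e = w \<and> apath u P (fst e) \<and> w \<notin> set (awalk_verts u P)"
proof -
  have "awalk u (P @ [e]) w \<longleftrightarrow> awalk u P (awlast u P) \<and> awalk (awlast u P) [e] w"
    by simp
  also have "\<dots> \<longleftrightarrow> e \<in> parcs G \<and> snd e = w \<and> awalk u P (fst e)"
    using arc_ends_in_verts[of e] by (auto simp: awalk_Cons_iff awalk_Nil_iff dest: awlast_eq)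
  finally show ?thesis
    by (auto simp: apath_def awalk_verts_snoc)
qed

text \<open>Exit times exceed entry times, so tracing tight arcs backwards strictly lowers the label
  and must end at the source. The induction counts the nodes with smaller label.\<close>

lemma label_solution_induct [consumes 3, case_names source arc]:
  assumes L: "label_solution T \<theta> L" and gt: "\<forall>e\<in>parcs G. \<forall>y. y < T e y"
    and w: "w \<in> pverts G"
    and source: "P s"
    and arc: "\<And>e. e \<in> parcs G \<Longrightarrow> snd e \<noteq> s \<Longrightarrow> T e (L (fst e)) \<le> L (snd e) \<Longrightarrow>
      L (fst e) < L (snd e) \<Longrightarrow> P (fst e) \<Longrightarrow> P (snd e)"
  shows "P w"
  using w
proof (induction "card {v \<in> pverts G. L v < L w}" arbitrary: w rule: less_induct)
  case less
  show ?case
  proof (cases "w = s")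
    case False
    then obtain e where e: "e \<in> parcs G" "snd e = w" "T e (L (fst e)) \<le> L w"
      using L less.prems unfolding label_solution_def by blast
    then have lt: "L (fst e) < L w"
      using gt by (meson less_le_trans)
    have fe: "fst e \<in> pverts G"
      using e(1) arc_ends_in_verts by blast
    have "{v \<in> pverts G. L v < L (fst e)} \<subset> {v \<in> pverts G. L v < L w}"
      using lt fe by auto
    then have "card {v \<in> pverts G. L v < L (fst e)} < card {v \<in> pverts G. L v < L w}"
      by (intro psubset_card_mono) auto
    then have "P (fst e)"
      using less.hyps fe by blast
    then show ?thesis
      using arc[of e] e lt False by auto
  qed (use source in simp)
qed

text \<open>A subsolution cannot overtake \<open>L\<close> along tight arcs, by monotonicity of the
  exit times. Used in both directions this gives uniqueness of labels; used for shifted labels it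
  gives growth bounds.\<close>

lemma label_solution_greatest:
  assumes L: "label_solution T \<theta> L" and gt: "\<forall>e\<in>parcs G. \<forall>y. y < T e y"
    and mono: "\<And>e. e \<in> parcs G \<Longrightarrow> mono (T e)"
    and M: "M s \<le> \<theta>" "\<And>e. e \<in> parcs G \<Longrightarrow> M (snd e) \<le> T e (M (fst e))"
    and w: "w \<in> pverts G"
  shows "M w \<le> L w"
  using L gt w
proof (induction rule: label_solution_induct)
  case source
  then show ?case using L M by (simp add: label_solution_def)
next
  case (arc e)
  then show ?case
    using M(2)[of e] monoD[OF mono, of e "M (fst e)" "L (fst e)"] by simp
qed

text \<open>Labels increase strictly along tight arcs, which keeps the walk simple. Every tail on
  the path has a label below that of \<open>w\<close>; for the sink this means that no routed flow
  leaves it again.\<close>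

lemma tight_path_exists:
  assumes L: "label_solution T \<theta> L" and gt: "\<forall>e\<in>parcs G. \<forall>y. y < T e y"
    and w: "w \<in> pverts G"
  shows "\<exists>P. apath s P w \<and> (\<forall>e\<in>set P. e \<in> parcs G \<and> T e (L (fst e)) \<le> L (snd e) \<and> fst e \<noteq> w)"
proof -
  have "\<exists>P. apath s P w \<and> (\<forall>x\<in>set (awalk_verts s P). L x \<le> L w) \<and>
      (\<forall>e\<in>set P. e \<in> parcs G \<and> T e (L (fst e)) \<le> L (snd e) \<and> L (fst e) < L w)"
    (is "?P w")
    using L gt w
  proof (induction rule: label_solution_induct)
    case source
    then show ?case
      using source_in_verts by (intro exI[of _ "[]"]) (auto simp: apath_Nil_iff)
  next
    case (arc e)
    then obtain P where P: "apath s P (fst e)" "\<forall>x\<in>set (awalk_verts s P). L x \<le> L (fst e)"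
      "\<forall>e\<in>set P. e \<in> parcs G \<and> T e (L (fst e)) \<le> L (snd e)"
      "\<forall>e'\<in>set P. L (fst e') < L (fst e)"
      by blast
    have "snd e \<notin> set (awalk_verts s P)"
      using P(2) arc by fastforce
    then have path: "apath s (P @ [e]) (snd e)"
      using P(1) arc(1) by (simp add: apath_snoc_iff)
    have "awalk s P (fst e)"
      using P(1) by (simp add: apath_def)
    then have "set (awalk_verts s (P @ [e])) = insert (snd e) (set (awalk_verts s P))"
      by (simp add: awalk_verts_snoc)
    then show ?case
      using path P arc by (intro exI[of _ "P @ [e]"]) force
  qed
  then show ?thesis by blast
qed

definition label :: "('v \<times> 'v \<Rightarrow> real \<Rightarrow> real) \<Rightarrow> real \<Rightarrow> 'v \<Rightarrow> real" where
  "label T \<theta> w = Min {fold T P \<theta> | P. apath s P w}"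

text \<open>Bellman's principle for simple paths: the last arc of a minimal path is tight, because
  the prefix arrives no earlier than the label there and exit times are monotone.\<close>

lemma label_solution_label:
  assumes ge: "\<And>e y. e \<in> parcs G \<Longrightarrow> y \<le> T e y" and mono: "\<And>e. e \<in> parcs G \<Longrightarrow> mono (T e)"
  shows "label_solution T \<theta> (label T \<theta>)"
proof -
  have fin: "finite {fold T P \<theta> | P. apath s P w}" for w
  proof -
    have "{fold T P \<theta> | P. apath s P w} = (\<lambda>P. fold T P \<theta>) ` {P. apath s P w}" by auto
    then show ?thesis using apaths_finite[of s w] by simp
  qed
  have le: "label T \<theta> w \<le> fold T P \<theta>" if "apath s P w" for P w
    unfolding label_def using that fin by (intro Min_le) auto
  have attained: "\<exists>P. apath s P w \<and> label T \<theta> w = fold T P \<theta>" if "w \<in> pverts G" for w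
  proof -
    have "{fold T P \<theta> | P. apath s P w} \<noteq> {}"
      using all_reachable[OF that] reachable_apath by auto
    from Min_in[OF fin this] show ?thesis by (auto simp: label_def)
  qed
  have source: "apath s P s \<longleftrightarrow> P = []" for P
    using source_in_verts apath_nonempty_ends by (auto simp: apath_Nil_iff)
  have fold_mono: "\<theta>1 \<le> fold T P \<theta>1" if "set P \<subseteq> parcs G" for P \<theta>1
    using that
    by (induction P arbitrary: \<theta>1) (auto intro: order_trans[OF ge])
  show ?thesis
    unfolding label_solution_def
  proof (intro conjI ballI)
    show "label T \<theta> s = \<theta>"
      by (simp add: label_def source)
    fix e assume e: "e \<in> parcs G"
    obtain P where P: "apath s P (fst e)" "label T \<theta> (fst e) = fold T P \<theta>"
      using attained arc_ends_in_verts[OF e] by blast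
    show "label T \<theta> (snd e) \<le> T e (label T \<theta> (fst e))"
    proof (cases "snd e \<in> set (awalk_verts s P)")
      \<comment> \<open>Appending \<open>e\<close> would close a cycle. The prefix of
        \<open>P\<close> up to \<open>snd e\<close> is itself a simple path, and the part cut off
        cannot decrease the time.\<close>
      case True
      then obtain P1 P2 where P12: "P = P1 @ P2" "awalk s P1 (snd e)" "awalk (snd e) P2 (fst e)"
        using P(1) awalk_decomp[of s P "fst e" "snd e"] by (auto simp: apath_def)
      then have "apath s P1 (snd e)" "set P2 \<subseteq> parcs G"
        using P(1) apath_append_iff[of s P1 P2] awlast_eq[OF P12(2)] by (auto elim: awalkE')
      then show ?thesis
        using le[of P1 "snd e"] fold_mono[of P2 "fold T P1 \<theta>"] ge[OF e, of "fold T P \<theta>"] P(2) P12(1) by simp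
    next
      case False
      then have "apath s (P @ [e]) (snd e)"
        using e P(1) by (simp add: apath_snoc_iff)
      then show ?thesis
        using le[of "P @ [e]"] P(2) by simp
    qed
  next
    fix w assume w: "w \<in> pverts G - {s}"
    then obtain P where P: "apath s P w" "label T \<theta> w = fold T P \<theta>"
      using attained by blast
    then have "P \<noteq> []" using w by (auto simp: apath_Nil_iff)
    then obtain P1 e where Pe: "P = P1 @ [e]" by (metis rev_exhaust)
    then have "e \<in> parcs G" "snd e = w" "apath s P1 (fst e)"
      using P(1) by (auto simp: apath_snoc_iff)
    then show "\<exists>e\<in>parcs G. snd e = w \<and> T e (label T \<theta> (fst e)) \<le> label T \<theta> w"
      using le[of P1 "fst e"] P(2) Pe monoD[OF mono, of e] by (intro bexI[of _ e]) auto
  qed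
qed

end

section \<open>The Euler scheme\<close>

context fluid_network
begin

lemma awalk_balance:
  assumes "awalk u P w"
  shows "(\<Sum>e\<in>out_arcs (with_proj G) v. real (count_list P e)) - (\<Sum>e\<in>in_arcs (with_proj G) v. real (count_list P e))
    = (if v = u then 1 else 0) - (if v = w then 1 else 0)"
  using assms
proof (induction P arbitrary: u)
  case Nil
  then show ?case by (simp add: awalk_Nil_iff)
next
  case (Cons e P)
  then have e: "e \<in> parcs G" "fst e = u" and P: "awalk (snd e) P w"
    by (auto simp: awalk_Cons_iff)
  have *: "(\<Sum>e'\<in>A. real (count_list (e # P) e')) = (\<Sum>e'\<in>A. real (count_list P e')) + (if e \<in> A then 1 else 0)"
    if "finite A" for A
  proof -
    have "(\<Sum>e'\<in>A. real (count_list (e # P) e')) = (\<Sum>e'\<in>A. real (count_list P e') + (if e' = e then 1 else 0))"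
      by (intro sum.cong) auto
    also have "\<dots> = (\<Sum>e'\<in>A. real (count_list P e')) + (if e \<in> A then 1 else 0)"
      using that by (simp add: sum.distrib)
    finally show ?thesis .
  qed
  have "e \<in> out_arcs (with_proj G) v \<longleftrightarrow> v = u" "e \<in> in_arcs (with_proj G) v \<longleftrightarrow> v = snd e"
    using e by (auto simp: out_arcs_def in_arcs_def)
  then show ?case
    using Cons.IH[OF P] by (simp add: * finite_out_arcs finite_in_arcs del: count_list.simps)
qed

text \<open>The arcs of a simple path are distinct, so the multiplicities in the balance of a walk
  are indicators.\<close>

lemma apath_balance:
  assumes "apath u P w"
  shows "(\<Sum>e\<in>out_arcs (with_proj G) v. if e \<in> set P then c else 0) -
      (\<Sum>e\<in>in_arcs (with_proj G) v. if e \<in> set P then c else 0)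
    = c * ((if v = u then 1 else 0) - (if v = w then 1 else (0::real)))"
proof -
  have "distinct P"
    using assms distinct_verts_imp_distinct by (auto simp: apath_def)
  then have c: "(if e \<in> set P then c else 0) = c * real (count_list P e)" for e
    by (induction P) (auto simp: count_list_0_iff)
  have "awalk u P w" using assms by (simp add: apath_def)
  from awalk_balance[OF this, of v, symmetric] show ?thesis
    unfolding c sum_distrib_left[symmetric] by (simp add: right_diff_distrib)
qed

end

section \<open>The network with its cumulative inflow, and the discrete scheme\<close>

locale cumulative_inflow = fluid_network G \<nu> s t
  for G :: "'v pair_pre_digraph" and \<nu> and s t :: 'v +
  fixes \<tau> :: "'v \<times> 'v \<Rightarrow> real" and W :: "real \<Rightarrow> real"
  assumes travel_time_pos: "\<And>e. e \<in> parcs G \<Longrightarrow> 0 < \<tau> e"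
    and inflow_mono: "mono W"
    and inflow_cont: "\<And>x. isCont W x"
    and inflow_neg: "\<And>x. x \<le> 0 \<Longrightarrow> W x = 0"
begin

definition inv_rate :: real where
  "inv_rate = (\<Sum>e\<in>parcs G. 1 / \<nu> e)"

text \<open>The common bound for the growth of labels and exit times: a label advances at most as
  far as the departure time does, plus the queueing delay that the new inflow can cause, and
  \<open>inv_rate\<close> bounds every \<open>1 / \<nu> e\<close>.\<close>

definition modulus :: "real \<Rightarrow> real" where
  "modulus x = x + inv_rate * W x"

lemma inv_rate_ge: "e \<in> parcs G \<Longrightarrow> 1 / \<nu> e \<le> inv_rate"
  unfolding inv_rate_def using service_rate_pos
  by (intro member_le_sum) (auto simp: less_imp_le)

lemma inv_rate_nonneg: "0 \<le> inv_rate"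
  unfolding inv_rate_def using service_rate_pos by (intro sum_nonneg) (auto simp: less_imp_le)

lemma modulus_mono: "a \<le> b \<Longrightarrow> modulus a \<le> modulus b"
  unfolding modulus_def using inv_rate_nonneg monoD[OF inflow_mono, of a b]
  by (intro add_mono mult_left_mono) auto

lemma modulus_cont: "isCont modulus x"
  unfolding modulus_def[abs_def] using inflow_cont by (intro continuous_intros) auto

lemma modulus_neg: "x \<le> 0 \<Longrightarrow> modulus x = x"
  by (simp add: modulus_def inflow_neg)

text \<open>Free-flow distances from the source, which give the labels while the network is still
  empty.\<close>

definition free_label :: "'v \<Rightarrow> real" where
  "free_label = label (\<lambda>e y. y + \<tau> e) 0"

text \<open>\<open>c e\<close> is the time by which the flow already on \<open>e\<close> has left
  it; an entry at \<open>y\<close> exits when both this and its own free travel are over.\<close>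

abbreviation queued :: "('v \<times> 'v \<Rightarrow> real) \<Rightarrow> 'v \<times> 'v \<Rightarrow> real \<Rightarrow> real" where
  "queued c e y \<equiv> max (y + \<tau> e) (c e)"

lemma queued_gt: "\<forall>e\<in>parcs G. \<forall>y. y < queued c e y"
  using travel_time_pos by (auto simp: less_max_iff_disj)

lemma queued_mono: "mono (queued c e)"
  by (auto simp: mono_def)

lemma label_solution_queued: "label_solution (queued c) \<theta> (label (queued c) \<theta>)"
  using queued_gt queued_mono by (intro label_solution_label) (auto intro: less_imp_le)

lemma label_queued_greatest:
  assumes L: "label_solution (queued c) \<theta> L" and M: "M s \<le> \<theta>"
    "\<And>e. e \<in> parcs G \<Longrightarrow> M (snd e) \<le> queued c e (M (fst e))"
    and w: "w \<in> pverts G"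
  shows "M w \<le> L w"
  by (rule label_solution_greatest[OF L queued_gt _ M w]) (rule queued_mono)

definition path_inflow :: "real \<Rightarrow> nat \<Rightarrow> ('v \<times> 'v) list \<Rightarrow> 'v \<times> 'v \<Rightarrow> real" where
  "path_inflow \<delta> k P e = (if e \<in> set P then W (real (Suc k) * \<delta>) - W (real k * \<delta>) else 0)"

lemma path_inflow_nonneg: "0 \<le> \<delta> \<Longrightarrow> 0 \<le> path_inflow \<delta> k P e"
  unfolding path_inflow_def using monoD[OF inflow_mono, of "real k * \<delta>" "real (Suc k) * \<delta>"]
  by (auto simp: mult_right_mono)

text \<open>The state carried between steps is a clearing time for every arc. It determines labels,
  exit times and a tight path to the sink; the inflow sent along that path postpones clearing by the
  time needed to serve it.\<close>

lemma euler_scheme: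
  assumes \<delta>: "0 < \<delta>"
  obtains L :: "nat \<Rightarrow> 'v \<Rightarrow> real" and q :: "nat \<Rightarrow> 'v \<times> 'v \<Rightarrow> real" and P :: "nat \<Rightarrow> ('v \<times> 'v) list"
  where "\<And>k. label_solution (queued (q k)) (real k * \<delta>) (L k)"
    and "\<And>k e. L k (fst e) + \<tau> e \<le> q k e"
    and "\<And>k e. q (Suc k) e = max (L (Suc k) (fst e) + \<tau> e) (q k e + path_inflow \<delta> k (P k) e / \<nu> e)"
    and "\<And>v. v \<in> pverts G \<Longrightarrow> L 0 v = free_label v"
    and "\<And>e. e \<in> parcs G \<Longrightarrow> q 0 e = L 0 (fst e) + \<tau> e"
    and "\<And>k. apath s (P k) t"
    and "\<And>k e. e \<in> set (P k) \<Longrightarrow> e \<in> parcs G \<and> q k e \<le> L k (snd e) \<and> fst e \<noteq> t"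
proof -
  define lab where "lab k c = label (queued c) (real k * \<delta>)" for k c
  define exi where "exi k c e = queued c e (lab k c (fst e))" for k c e
  define path where "path k c = (SOME P. apath s P t \<and>
    (\<forall>e\<in>set P. e \<in> parcs G \<and> exi k c e \<le> lab k c (snd e) \<and> fst e \<noteq> t))" for k c
  have sol: "label_solution (queued c) (real k * \<delta>) (lab k c)" for k c
    unfolding lab_def by (rule label_solution_queued)
  have path: "apath s (path k c) t \<and>
    (\<forall>e\<in>set (path k c). e \<in> parcs G \<and> exi k c e \<le> lab k c (snd e) \<and> fst e \<noteq> t)" for k c
    unfolding path_def
    by (rule someI_ex) (use tight_path_exists[OF sol queued_gt sink_in_verts] in \<open>auto simp: exi_def\<close>)
  define c where "c = rec_nat (\<lambda>e. free_label (fst e) + \<tau> e)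
    (\<lambda>k c e. exi k c e + path_inflow \<delta> k (path k c) e / \<nu> e)"
  have c_Suc: "c (Suc k) = (\<lambda>e. exi k (c k) e + path_inflow \<delta> k (path k (c k)) e / \<nu> e)" for k
    by (simp add: c_def)
  have c_0: "c 0 = (\<lambda>e. free_label (fst e) + \<tau> e)"
    by (simp add: c_def)
  have free: "label_solution (\<lambda>e y. y + \<tau> e) 0 free_label"
    unfolding free_label_def using travel_time_pos
    by (intro label_solution_label) (auto simp: mono_def less_imp_le)
  \<comment> \<open>Initially the clearing times equal the free-flow exit times at the free labels,
    so the maximum in \<open>queued\<close> changes nothing there and the first labels are the free
    ones.\<close>
  then have free': "label_solution (queued (c 0)) 0 free_label"
    by (auto simp: label_solution_def c_0)
  have L0: "lab 0 (c 0) v = free_label v" if "v \<in> pverts G" for v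
  proof (rule antisym)
    show "lab 0 (c 0) v \<le> free_label v"
      using sol[of "c 0" 0] that
      by (intro label_queued_greatest[OF free']) (auto simp: label_solution_def)
    show "free_label v \<le> lab 0 (c 0) v"
      using free' that
      by (intro label_queued_greatest[OF sol[of "c 0" 0]]) (auto simp: label_solution_def)
  qed
  show ?thesis
  proof (rule that[of "\<lambda>k. exi k (c k)" "\<lambda>k. lab k (c k)" "\<lambda>k. path k (c k)"])
    \<comment> \<open>At the labels themselves, replacing the clearing time by the exit time leaves
      the maximum unchanged.\<close>
    show "label_solution (queued (exi k (c k))) (real k * \<delta>) (lab k (c k))" for k
      using sol[of "c k" k] by (auto simp: label_solution_def exi_def)
    show "lab k (c k) (fst e) + \<tau> e \<le> exi k (c k) e" for k e
      by (simp add: exi_def)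
    show "exi (Suc k) (c (Suc k)) e = max (lab (Suc k) (c (Suc k)) (fst e) + \<tau> e)
        (exi k (c k) e + path_inflow \<delta> k (path k (c k)) e / \<nu> e)" for k e
      by (simp add: exi_def[of "Suc k"] c_Suc)
    show "exi 0 (c 0) e = lab 0 (c 0) (fst e) + \<tau> e" if "e \<in> parcs G" for e
      using L0 arc_ends_in_verts[OF that] by (simp add: exi_def c_0)
  qed (use path L0 in blast)+
qed

end

lemma increments_sum_le:
  fixes f g :: "nat \<Rightarrow> real"
  assumes "\<And>k. f (Suc k) - f k \<le> g (Suc k) - g k" "j \<le> k"
  shows "f k - f j \<le> g k - g j"
proof -
  have "f k - g k \<le> f j - g j"
    using assms(2) by (rule lift_Suc_antimono_le[rotated]) (use assms(1) in \<open>simp add: algebra_simps\<close>)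
  then show ?thesis by simp
qed

text \<open>The discretisation error enters only through \<^term>\<open>\<delta>\<close>, so an exact solution is the case
  \<^term>\<open>\<delta> = (0::real)\<close>. For \<^term>\<open>\<theta> \<le> (0::real)\<close> the network is empty.\<close>

locale approx_solution = cumulative_inflow G \<nu> s t \<tau> W
  for G :: "'v pair_pre_digraph" and \<nu> and s t :: 'v and \<tau> W +
  fixes \<delta> :: real and l :: "'v \<Rightarrow> real \<Rightarrow> real" and q x :: "'v \<times> 'v \<Rightarrow> real \<Rightarrow> real"
  assumes l_mono: "\<And>v a b. v \<in> pverts G \<Longrightarrow> a \<le> b \<Longrightarrow> l v a \<le> l v b"
    and l_growth: "\<And>v a b. v \<in> pverts G \<Longrightarrow> a \<le> b \<Longrightarrow> l v b - l v a \<le> modulus b - modulus (a - \<delta>)"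
    and q_mono: "\<And>e a b. e \<in> parcs G \<Longrightarrow> a \<le> b \<Longrightarrow> q e a \<le> q e b"
    and q_growth: "\<And>e a b. e \<in> parcs G \<Longrightarrow> a \<le> b \<Longrightarrow> q e b - q e a \<le> modulus b - modulus (a - \<delta>)"
    and l_source: "\<And>\<theta>. \<theta> - \<delta> \<le> l s \<theta> \<and> l s \<theta> \<le> \<theta>"
    and l_le_q: "\<And>e \<theta>. e \<in> parcs G \<Longrightarrow> l (snd e) \<theta> \<le> q e \<theta>"
    and l_tight: "\<And>w \<theta>. w \<in> pverts G - {s} \<Longrightarrow> \<exists>e\<in>parcs G. snd e = w \<and> q e \<theta> \<le> l w \<theta>"
    and q_ge: "\<And>e \<theta>. e \<in> parcs G \<Longrightarrow> l (fst e) \<theta> + \<tau> e \<le> q e \<theta>"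
    and capacity: "\<And>e a b. e \<in> parcs G \<Longrightarrow> a \<le> b \<Longrightarrow> x e b - x e a \<le> \<nu> e * (q e b - q e a)"
    and queue: "\<And>e \<theta>. e \<in> parcs G \<Longrightarrow>
      \<exists>\<sigma>\<in>{min 0 \<theta>..\<theta>}. \<nu> e * (q e \<theta> - \<tau> e - l (fst e) \<sigma>) \<le> x e \<theta> - x e \<sigma>"
    and active: "\<And>e a b. e \<in> parcs G \<Longrightarrow> a \<le> b \<Longrightarrow> x e a \<noteq> x e b \<Longrightarrow>
      \<exists>\<sigma>\<in>{a - \<delta>..b}. q e \<sigma> \<le> l (snd e) \<sigma>"
    and conservation: "\<And>v \<theta>. v \<in> pverts G - {s, t} \<Longrightarrow>
      (\<Sum>e\<in>out_arcs (with_proj G) v. x e \<theta>) = (\<Sum>e\<in>in_arcs (with_proj G) v. x e \<theta>)"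
    and conservation_source: "\<And>\<theta>.
      W (\<theta> - \<delta>) \<le> (\<Sum>e\<in>out_arcs (with_proj G) s. x e \<theta>) - (\<Sum>e\<in>in_arcs (with_proj G) s. x e \<theta>) \<and>
      (\<Sum>e\<in>out_arcs (with_proj G) s. x e \<theta>) - (\<Sum>e\<in>in_arcs (with_proj G) s. x e \<theta>) \<le> W \<theta>"
    and x_mono: "\<And>e a b. e \<in> parcs G \<Longrightarrow> a \<le> b \<Longrightarrow> x e a \<le> x e b"
    and x_growth: "\<And>e a b. e \<in> parcs G \<Longrightarrow> a \<le> b \<Longrightarrow> x e b - x e a \<le> W b - W (a - \<delta>)"
    and x_neg: "\<And>e \<theta>. e \<in> parcs G \<Longrightarrow> \<theta> \<le> 0 \<Longrightarrow> x e \<theta> = 0"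
    and x_sink: "\<And>e \<theta>. e \<in> parcs G \<Longrightarrow> fst e = t \<Longrightarrow> x e \<theta> = 0"
    and l_neg: "\<And>v \<theta>. v \<in> pverts G \<Longrightarrow> \<theta> \<le> 0 \<Longrightarrow> l v \<theta> = free_label v + \<theta>"
    and q_neg: "\<And>e \<theta>. e \<in> parcs G \<Longrightarrow> \<theta> \<le> 0 \<Longrightarrow> q e \<theta> = free_label (fst e) + \<tau> e + \<theta>"

context cumulative_inflow
begin

text \<open>The scheme is extended to all departure times by rounding down to the grid. The summand
  \<open>min 0 \<theta>\<close> continues labels and exit times to negative times, where they move
  along with \<open>\<theta>\<close>.\<close>

lemma approx_solution_exists:
  assumes \<delta>: "0 < \<delta>"
  shows "\<exists>l q x. approx_solution G \<nu> s t \<tau> W \<delta> l q x"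
proof -
  obtain L q P where sol: "\<And>k. label_solution (queued (q k)) (real k * \<delta>) (L k)"
    and q_ge: "\<And>k e. L k (fst e) + \<tau> e \<le> q k e"
    and q_Suc: "\<And>k e. q (Suc k) e = max (L (Suc k) (fst e) + \<tau> e) (q k e + path_inflow \<delta> k (P k) e / \<nu> e)"
    and L_0: "\<And>v. v \<in> pverts G \<Longrightarrow> L 0 v = free_label v"
    and q_0: "\<And>e. e \<in> parcs G \<Longrightarrow> q 0 e = L 0 (fst e) + \<tau> e"
    and P: "\<And>k. apath s (P k) t"
    and P_tight: "\<And>k e. e \<in> set (P k) \<Longrightarrow> e \<in> parcs G \<and> q k e \<le> L k (snd e) \<and> fst e \<noteq> t"
    by (rule euler_scheme[OF \<delta>]) (rule that, assumption+)
  define X where "X k e = (\<Sum>j<k. path_inflow \<delta> j (P j) e)" for k e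
  have y: "0 \<le> path_inflow \<delta> k P e" "path_inflow \<delta> k P e \<le> W (real (Suc k) * \<delta>) - W (real k * \<delta>)" for k P e
    using path_inflow_nonneg[of \<delta> k "[e]" e] path_inflow_nonneg[of \<delta> k P e] \<delta> by (auto simp: path_inflow_def)
  have X_Suc: "X (Suc k) e = X k e + path_inflow \<delta> k (P k) e" for k e
    by (simp add: X_def)
  have q_step: "q k e + path_inflow \<delta> k (P k) e / \<nu> e \<le> q (Suc k) e" for k e
    by (simp add: q_Suc)
  \<comment> \<open>The labels of step \<open>k\<close> are a subsolution for step
    \<open>Suc k\<close>, since exit times only increase.\<close>
  have L_Suc: "L k v \<le> L (Suc k) v" if v: "v \<in> pverts G" for k v
  proof (rule label_queued_greatest[OF sol[of "Suc k"] _ _ v])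
    show "L k s \<le> real (Suc k) * \<delta>"
      using sol[of k] \<delta> by (simp add: label_solution_def algebra_simps)
    fix e assume e: "e \<in> parcs G"
    then have "L k (snd e) \<le> queued (q k) e (L k (fst e))"
      using sol[of k] by (simp add: label_solution_def)
    moreover have "q k e \<le> q (Suc k) e"
      using q_step[of k e] y(1)[of k "P k" e] service_rate_pos[OF e]
      by (smt (verit) divide_nonneg_pos)
    ultimately show "L k (snd e) \<le> queued (q (Suc k)) e (L k (fst e))"
      by auto
  qed
  define M where "M k = modulus (real k * \<delta>)" for k
  have M_Suc: "M (Suc k) - M k = \<delta> + inv_rate * (W (real (Suc k) * \<delta>) - W (real k * \<delta>))" for k
    by (simp add: M_def modulus_def algebra_simps)
  have dW: "0 \<le> W (real (Suc k) * \<delta>) - W (real k * \<delta>)" for k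
    using monoD[OF inflow_mono, of "real k * \<delta>" "real (Suc k) * \<delta>"] \<delta> by (simp add: mult_right_mono)
  have y_M: "path_inflow \<delta> k (P k) e / \<nu> e \<le> M (Suc k) - M k" if e: "e \<in> parcs G" for k e
  proof -
    have "path_inflow \<delta> k (P k) e / \<nu> e = 1 / \<nu> e * path_inflow \<delta> k (P k) e"
      by simp
    also have "\<dots> \<le> inv_rate * (W (real (Suc k) * \<delta>) - W (real k * \<delta>))"
      using inv_rate_ge[OF e] inv_rate_nonneg y by (intro mult_mono) auto
    finally show ?thesis using \<delta> M_Suc[of k] by simp
  qed
  \<comment> \<open>Conversely, the new labels shifted back by the increment of \<open>M\<close> are
    a subsolution of the old system, because the delay added to any arc is at most that
    increment.\<close>
  have L_step: "L (Suc k) v - L k v \<le> M (Suc k) - M k" if v: "v \<in> pverts G" for k v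
  proof -
    have "L (Suc k) v - (M (Suc k) - M k) \<le> L k v"
    proof (rule label_queued_greatest[OF sol[of k] _ _ v])
      show "L (Suc k) s - (M (Suc k) - M k) \<le> real k * \<delta>"
        using sol[of "Suc k"] dW[of k] inv_rate_nonneg 
        by (simp add: label_solution_def M_Suc algebra_simps mult_left_mono)
      fix e assume e: "e \<in> parcs G"
      then have "L (Suc k) (snd e) \<le> q (Suc k) e"
        using sol[of "Suc k"] q_ge[of "Suc k" e] by (auto simp: label_solution_def max_def split: if_splits)
      then show "L (Suc k) (snd e) - (M (Suc k) - M k) \<le> queued (q k) e (L (Suc k) (fst e) - (M (Suc k) - M k))"
        using y_M[OF e, of k] by (auto simp: q_Suc max_def split: if_splits)
    qed
    then show ?thesis by simp
  qed
  have q_Suc_le: "q (Suc k) e - q k e \<le> M (Suc k) - M k" if e: "e \<in> parcs G" for k e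
    using L_step[of "fst e" k] arc_ends_in_verts[OF e] q_ge[of k e] y_M[OF e, of k]
    by (auto simp: q_Suc max_def split: if_splits)
  have q_mono': "q k e \<le> q (Suc k) e" if e: "e \<in> parcs G" for k e
    using q_step[of k e] divide_nonneg_pos[OF y(1)[of k "P k" e] service_rate_pos[OF e]] by linarith
  define n where "n \<theta> = nat \<lfloor>\<theta> / \<delta>\<rfloor>" for \<theta>
  have n_mono: "n a \<le> n b" if "a \<le> b" for a b
    unfolding n_def using that \<delta> by (intro nat_mono floor_mono divide_right_mono) auto
  have n_neg: "n \<theta> = 0" if "\<theta> \<le> 0" for \<theta>
  proof -
    have "\<theta> / \<delta> \<le> 0" using that \<delta> by (simp add: divide_le_0_iff)
    then show ?thesis unfolding n_def by linarith
  qed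
  have n_le: "real (n \<theta>) * \<delta> \<le> max 0 \<theta>" for \<theta>
  proof (cases "\<theta> \<le> 0")
    case False
    then have "real (n \<theta>) \<le> \<theta> / \<delta>" using \<delta> by (simp add: n_def)
    then show ?thesis using False \<delta> by (simp add: pos_le_divide_eq)
  qed (simp add: n_neg)
  have n_ge: "\<theta> - \<delta> \<le> real (n \<theta>) * \<delta>" for \<theta>
  proof -
    have "\<theta> / \<delta> - 1 \<le> real (n \<theta>)" unfolding n_def by linarith
    then have "(\<theta> / \<delta> - 1) * \<delta> \<le> real (n \<theta>) * \<delta>" using \<delta> by (intro mult_right_mono) auto
    then show ?thesis using \<delta> by (simp add: left_diff_distrib)
  qed
  have n_grid: "n (real j * \<delta>) = j" for j
    using \<delta> by (simp add: n_def)
  have W_n: "W (\<theta> - \<delta>) \<le> W (real (n \<theta>) * \<delta>) \<and> W (real (n \<theta>) * \<delta>) \<le> W \<theta>" for \<theta>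
    using monoD[OF inflow_mono n_ge[of \<theta>]] monoD[OF inflow_mono n_le[of \<theta>]] inflow_neg[of \<theta>] inflow_neg[of 0]
    by (auto simp: max_def split: if_splits)
  have incr: "f (n a) + min 0 a \<le> f (n b) + min 0 b \<and>
      f (n b) + min 0 b - (f (n a) + min 0 a) \<le> modulus b - modulus (a - \<delta>)"
    if f: "\<And>k. f k \<le> f (Suc k)" "\<And>k. f (Suc k) - f k \<le> M (Suc k) - M k" and ab: "a \<le> b"
    for f :: "nat \<Rightarrow> real" and a b
  proof
    have "f (n a) \<le> f (n b)"
      using f(1) n_mono[OF ab] by (rule lift_Suc_mono_le)
    then show "f (n a) + min 0 a \<le> f (n b) + min 0 b"
      using ab by auto
    have "f (n b) - f (n a) \<le> modulus (real (n b) * \<delta>) - modulus (real (n a) * \<delta>)"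
      using increments_sum_le[of f M, OF f(2) n_mono[OF ab]] by (simp add: M_def)
    moreover have "modulus (real (n b) * \<delta>) \<le> modulus (max 0 b)"
      by (rule modulus_mono[OF n_le])
    moreover have "modulus (a - \<delta>) \<le> modulus (real (n a) * \<delta>)"
      by (rule modulus_mono[OF n_ge])
    ultimately show "f (n b) + min 0 b - (f (n a) + min 0 a) \<le> modulus b - modulus (a - \<delta>)"
      using \<delta> ab n_neg[of a] modulus_neg[of "a - \<delta>"] modulus_neg[of b] modulus_neg[of 0]
      by (auto simp: min_def max_def split: if_splits)
  qed
  have X_incr: "X j e \<le> X k e" if "j \<le> k" for j k e
  proof (rule lift_Suc_mono_le[OF _ that])
    show "X k e \<le> X (Suc k) e" for k
      using y(1) by (simp add: X_Suc)
  qed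
  \<comment> \<open>\<open>j\<close> is the last step up to \<open>k\<close> at which
    \<open>e\<close> had no queue; since then every inflow has postponed the exit time by exactly
    its service time.\<close>
  have queue: "\<exists>j\<le>k. q k e = L j (fst e) + \<tau> e + (X k e - X j e) / \<nu> e" if e: "e \<in> parcs G" for k e
  proof (induction k)
    case 0
    then show ?case using q_0[OF e] by simp
  next
    case (Suc k)
    then obtain j where j: "j \<le> k" "q k e = L j (fst e) + \<tau> e + (X k e - X j e) / \<nu> e" by blast
    show ?case
    proof (cases "q (Suc k) e = L (Suc k) (fst e) + \<tau> e")
      case False
      then have "q (Suc k) e = q k e + path_inflow \<delta> k (P k) e / \<nu> e"
        using q_Suc[of k e] by linarith
      then show ?thesis
        using j by (intro exI[of _ j]) (simp add: X_Suc add_divide_distrib diff_divide_distrib)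
    qed auto
  qed
  have balance: "(\<Sum>e\<in>out_arcs (with_proj G) v. X k e) - (\<Sum>e\<in>in_arcs (with_proj G) v. X k e)
      = W (real k * \<delta>) * ((if v = s then 1 else 0) - (if v = t then 1 else 0))" for k v
  proof (induction k)
    case 0
    then show ?case by (simp add: X_def inflow_neg)
  next
    case (Suc k)
    have "(\<Sum>e\<in>out_arcs (with_proj G) v. path_inflow \<delta> k (P k) e) - (\<Sum>e\<in>in_arcs (with_proj G) v. path_inflow \<delta> k (P k) e)
       = (W (real (Suc k) * \<delta>) - W (real k * \<delta>)) * ((if v = s then 1 else 0) - (if v = t then 1 else 0))"
      unfolding path_inflow_def by (rule apath_balance[OF P])
    with Suc show ?case
      unfolding X_Suc sum.distrib left_diff_distrib by linarith
  qed
  let ?l = "\<lambda>v \<theta>. L (n \<theta>) v + min 0 \<theta>" and ?q = "\<lambda>e \<theta>. q (n \<theta>) e + min 0 \<theta>"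
    and ?x = "\<lambda>e \<theta>. X (n \<theta>) e"
  have "approx_solution G \<nu> s t \<tau> W \<delta> ?l ?q ?x"
  proof (unfold_locales, goal_cases)
    case (1 v a b)
    then show ?case using incr[of "\<lambda>k. L k v", OF L_Suc L_step] by blast
  next
    case (2 v a b)
    then show ?case using incr[of "\<lambda>k. L k v", OF L_Suc L_step] by blast
  next
    case (3 e a b)
    then show ?case using incr[of "\<lambda>k. q k e", OF q_mono' q_Suc_le] by blast
  next
    case (4 e a b)
    then show ?case using incr[of "\<lambda>k. q k e", OF q_mono' q_Suc_le] by blast
  next
    case (5 \<theta>)
    have "L (n \<theta>) s = real (n \<theta>) * \<delta>" using sol[of "n \<theta>"] by (simp add: label_solution_def)
    then show ?case
      using n_neg[of \<theta>] n_le[of \<theta>] n_ge[of \<theta>] \<delta> by (auto simp: min_def max_def split: if_splits)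
  next
    case (6 e \<theta>)
    then show ?case
      using sol[of "n \<theta>"] q_ge[of "n \<theta>" e] by (auto simp: label_solution_def max_def split: if_splits)
  next
    case (7 w \<theta>)
    then show ?case using sol[of "n \<theta>"] unfolding label_solution_def by fastforce
  next
    case (8 e \<theta>)
    then show ?case using q_ge[of "n \<theta>" e] by simp
  next
    case (9 e a b)
    have "X (Suc k) e / \<nu> e - X k e / \<nu> e \<le> q (Suc k) e - q k e" for k
      using q_step[of k e] by (simp add: X_Suc add_divide_distrib)
    then have "X (n b) e / \<nu> e - X (n a) e / \<nu> e \<le> q (n b) e - q (n a) e"
      by (rule increments_sum_le[of "\<lambda>k. X k e / \<nu> e" "\<lambda>k. q k e"]) (rule n_mono[OF 9(2)])
    moreover have "min 0 a \<le> min 0 b"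
      using 9(2) by auto
    ultimately have "(X (n b) e - X (n a) e) / \<nu> e \<le> q (n b) e + min 0 b - (q (n a) e + min 0 a)"
      unfolding diff_divide_distrib by linarith
    then show ?case
      using service_rate_pos[OF 9(1)] by (simp add: pos_divide_le_eq mult.commute)
  next
    case (10 e \<theta>)
    show ?case
    proof (cases "\<theta> < 0")
      case True
      then show ?thesis using q_0[OF 10] n_neg[of \<theta>] by (intro bexI[of _ \<theta>]) auto
    next
      case False
      obtain j where j: "j \<le> n \<theta>" "q (n \<theta>) e = L j (fst e) + \<tau> e + (X (n \<theta>) e - X j e) / \<nu> e"
        using queue[OF 10] by blast
      have "real j * \<delta> \<le> real (n \<theta>) * \<delta>" using j(1) \<delta> by simp
      then have "real j * \<delta> \<le> \<theta>" using n_le[of \<theta>] False by linarith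
      then have "real j * \<delta> \<in> {min 0 \<theta>..\<theta>}"
        using False \<delta> by auto
      then show ?thesis
        using False j(2) \<delta> service_rate_pos[OF 10]
        by (intro bexI[of _ "real j * \<delta>"]) (auto simp: n_grid)
    qed
  next
    case (11 e a b)
    have "\<exists>j\<in>{n a..<n b}. path_inflow \<delta> j (P j) e \<noteq> 0"
    proof (rule ccontr)
      assume *: "\<not> ?thesis"
      have "X k e = X (n a) e" if "n a \<le> k" "k \<le> n b" for k
        using that
      proof (induction k rule: dec_induct)
        case (step k)
        then have "path_inflow \<delta> k (P k) e = 0" using * by simp
        then show ?case using step by (simp add: X_Suc)
      qed simp
      from this[of "n b"] show False using 11(3) n_mono[OF 11(2)] by (metis order_refl)
    qed
    then obtain j where j: "n a \<le> j" "j < n b" "e \<in> set (P j)"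
      by (auto simp: path_inflow_def split: if_splits)
    \<comment> \<open>The grid point at which \<open>e\<close> is tight may precede
      \<open>a\<close>, by at most \<open>\<delta>\<close>; this is the slack in the condition
      \<open>active\<close>.\<close>
    have "real (n a) * \<delta> \<le> real j * \<delta>" "real j * \<delta> \<le> real (n b) * \<delta>"
      using j \<delta> by auto
    moreover have "0 < b" using j(2) n_neg[of b] by linarith
    ultimately have "real j * \<delta> \<in> {a - \<delta>..b}"
      using n_ge[of a] n_le[of b] by auto
    then show ?case
      using P_tight[OF j(3)] \<delta> by (intro bexI[of _ "real j * \<delta>"]) (auto simp: n_grid)
  next
    case (12 v \<theta>)
    then show ?case using balance[of "n \<theta>" v] by simp
  next
    case (13 \<theta>)
    then show ?case using balance[of "n \<theta>" s] source_neq_sink W_n[of \<theta>] by simp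
  next
    case (14 e a b)
    then show ?case using X_incr n_mono by blast
  next
    case (15 e a b)
    have "X (n b) e - X (n a) e \<le> W (real (n b) * \<delta>) - W (real (n a) * \<delta>)"
      by (rule increments_sum_le[of "\<lambda>k. X k e" "\<lambda>k. W (real k * \<delta>)", OF _ n_mono[OF 15(2)]])
        (use y(2) in \<open>simp add: X_Suc del: of_nat_Suc\<close>)
    then show ?case using W_n[of a] W_n[of b] by linarith
  next
    case (16 e \<theta>)
    then show ?case by (simp add: n_neg X_def)
  next
    case (17 e \<theta>)
    then have "path_inflow \<delta> j (P j) e = 0" for j
      using P_tight[of e j] by (auto simp: path_inflow_def)
    then show ?case by (simp add: X_def)
  next
    case (18 v \<theta>)
    then show ?case by (simp add: n_neg L_0)
  next
    case (19 e \<theta>)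
    then show ?case using arc_ends_in_verts[of e] by (simp add: n_neg L_0 q_0)
  qed
  then show ?thesis by blast
qed

end

section \<open>Passage to the limit\<close>

text \<open>The index set may be uncountable, so compactness of a product of intervals need not
  yield a subsequence. Instead, a cluster point becomes a limit after refining the filter by the
  preimages of its neighbourhoods.\<close>

lemma pointwise_bounded_cluster:
  fixes f :: "'n \<Rightarrow> 'i \<Rightarrow> real"
  assumes F: "F \<noteq> bot" and bdd: "\<And>i. i \<in> I \<Longrightarrow> \<exists>B. \<forall>n. \<bar>f n i\<bar> \<le> B"
  obtains F' g where "F' \<le> F" "F' \<noteq> bot" "\<And>i. i \<in> I \<Longrightarrow> ((\<lambda>n. f n i) \<longlongrightarrow> g i) F'"
proof -
  obtain B where B: "\<And>i n. i \<in> I \<Longrightarrow> \<bar>f n i\<bar> \<le> B i"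
    using bchoice[of I "\<lambda>i B. \<forall>n. \<bar>f n i\<bar> \<le> B"] bdd by blast
  \<comment> \<open>Zero outside \<open>I\<close>, so that the functions lie in a compact product
    over the full index type.\<close>
  define f' where "f' n i = (if i \<in> I then f n i else 0)" for n i
  define K where "K = (\<Pi>\<^sub>E i\<in>UNIV. {- \<bar>B i\<bar>..\<bar>B i\<bar>})"
  have "compactin (product_topology (\<lambda>i. euclidean) UNIV) K"
    unfolding K_def compactin_PiE by simp
  then have K: "compact K"
    by (simp add: euclidean_product_topology)
  have f'K: "f' n \<in> K" for n
  proof -
    have "f' n i \<in> {- \<bar>B i\<bar>..\<bar>B i\<bar>}" for i
      using B[of i n] by (auto simp: f'_def)
    then show ?thesis by (simp add: K_def PiE_UNIV_domain)
  qed
  have "filtermap f' F \<noteq> bot"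
    using F by (simp add: filtermap_bot_iff)
  moreover have "eventually (\<lambda>y. y \<in> K) (filtermap f' F)"
    using f'K by (simp add: eventually_filtermap)
  ultimately obtain g where g: "inf (nhds g) (filtermap f' F) \<noteq> bot"
    using K unfolding compact_filter by blast
  define F' where "F' = inf F (filtercomap f' (nhds g))"
  show ?thesis
  proof (rule that)
    show "F' \<le> F" by (simp add: F'_def)
    show "F' \<noteq> bot"
    proof
      assume "F' = bot"
      then have "eventually (\<lambda>_. False) F'" by simp
      then obtain P Q where PQ: "eventually P F" "eventually Q (filtercomap f' (nhds g))" "\<And>n. P n \<Longrightarrow> Q n \<Longrightarrow> False"
        unfolding F'_def eventually_inf by blast
      obtain U where U: "eventually U (nhds g)" "\<And>n. U (f' n) \<Longrightarrow> Q n"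
        using PQ(2) unfolding eventually_filtercomap by blast
      have "eventually (\<lambda>y. \<not> U y) (filtermap f' F)"
        unfolding eventually_filtermap using PQ(1) by eventually_elim (use PQ(3) U(2) in blast)
      with U(1) have "eventually (\<lambda>_. False) (inf (nhds g) (filtermap f' F))"
        unfolding eventually_inf by blast
      with g show False using eventually_False by blast
    qed
    fix i assume i: "i \<in> I"
    have "filterlim f' (nhds g) F'"
      by (rule filterlim_mono[OF filterlim_filtercomap order_refl]) (simp add: F'_def)
    moreover have "((\<lambda>y. y i) \<longlongrightarrow> g i) (nhds g)"
    proof -
      have "\<forall>\<^sub>F y in nhds g. y i \<in> S" if "open S" "g i \<in> S" for S
        using that open_vimage[OF that(1) continuous_on_product_coordinates[of i]]
        by (auto simp: eventually_nhds vimage_def)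
      then show ?thesis by (simp add: tendsto_def)
    qed
    ultimately have "((\<lambda>n. f' n i) \<longlongrightarrow> g i) F'"
      by (rule filterlim_compose[rotated])
    then show "((\<lambda>n. f n i) \<longlongrightarrow> g i) F'"
      using i by (simp add: f'_def)
  qed
qed

text \<open>Equicontinuity up to the step size: as increments are dominated by those of
  \<open>m\<close>, convergence at the single point \<open>\<sigma>0\<close> extends to arguments
  tending to it, even though each \<open>f n\<close> may jump.\<close>

lemma tendsto_along_modulus:
  fixes f :: "'n \<Rightarrow> real \<Rightarrow> real" and m :: "real \<Rightarrow> real"
  assumes mono: "\<And>n a b. a \<le> b \<Longrightarrow> f n a \<le> f n b"
    and growth: "\<And>n a b. a \<le> b \<Longrightarrow> f n b - f n a \<le> m b - m (a - \<delta> n)"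
    and m: "\<And>x. isCont m x"
    and \<delta>: "(\<delta> \<longlongrightarrow> 0) F" and \<sigma>: "(\<sigma> \<longlongrightarrow> \<sigma>0) F"
    and lim: "((\<lambda>n. f n \<sigma>0) \<longlongrightarrow> g) F"
  shows "((\<lambda>n. f n (\<sigma> n)) \<longlongrightarrow> g) F"
proof -
  have "((\<lambda>n. m (max (\<sigma> n) \<sigma>0) - m (min (\<sigma> n) \<sigma>0 - \<delta> n)) \<longlongrightarrow> m (max \<sigma>0 \<sigma>0) - m (min \<sigma>0 \<sigma>0 - 0)) F"
    using \<sigma> \<delta> by (intro tendsto_intros isCont_tendsto_compose[OF m])
  then have "((\<lambda>n. m (max (\<sigma> n) \<sigma>0) - m (min (\<sigma> n) \<sigma>0 - \<delta> n)) \<longlongrightarrow> 0) F"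
    by simp
  moreover have "\<bar>f n (\<sigma> n) - f n \<sigma>0\<bar> \<le> m (max (\<sigma> n) \<sigma>0) - m (min (\<sigma> n) \<sigma>0 - \<delta> n)" for n
    using mono[of "\<sigma> n" \<sigma>0 n] mono[of \<sigma>0 "\<sigma> n" n] growth[of "\<sigma> n" \<sigma>0 n] growth[of \<sigma>0 "\<sigma> n" n]
    by (cases "\<sigma> n \<le> \<sigma>0") (auto simp: max_def min_def)
  ultimately have "((\<lambda>n. f n (\<sigma> n) - f n \<sigma>0) \<longlongrightarrow> 0) F"
    by (intro Lim_null_comparison[of "\<lambda>n. f n (\<sigma> n) - f n \<sigma>0"]) auto
  from tendsto_add[OF this lim] show ?thesis by simp
qed

lemma tendsto_eventually_less:
  fixes f g :: "'n \<Rightarrow> real"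
  assumes "(f \<longlongrightarrow> a) F" "(g \<longlongrightarrow> b) F" "a < b"
  shows "\<forall>\<^sub>F n in F. f n < g n"
proof -
  have "\<forall>\<^sub>F n in F. f n < (a + b) / 2"
    by (rule order_tendstoD(2)[OF assms(1)]) (use assms(3) in simp)
  moreover have "\<forall>\<^sub>F n in F. (a + b) / 2 < g n"
    by (rule order_tendstoD(1)[OF assms(2)]) (use assms(3) in simp)
  ultimately show ?thesis by eventually_elim simp
qed

context cumulative_inflow
begin

text \<open>Weak inequalities and equations pass to the limit directly. The existential over arcs
  uses that there are finitely many of them, and the existentials over departure times use a further
  refinement of the filter along which the witnesses converge.\<close>

lemma exact_solution_exists: "\<exists>l q x. approx_solution G \<nu> s t \<tau> W 0 l q x"
proof -
  define \<delta> where "\<delta> n = inverse (real (Suc n))" for n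
  have \<delta>_pos: "0 < \<delta> n" and \<delta>_le: "\<delta> n \<le> 1" for n
    by (auto simp: \<delta>_def field_simps)
  obtain ln qn xn where app: "\<And>n. approx_solution G \<nu> s t \<tau> W (\<delta> n) (ln n) (qn n) (xn n)"
    using approx_solution_exists[OF \<delta>_pos] by metis
  note appD = approx_solution.l_mono[OF app] approx_solution.l_growth[OF app]
    approx_solution.q_mono[OF app] approx_solution.q_growth[OF app]
    approx_solution.x_mono[OF app] approx_solution.x_growth[OF app]
  \<comment> \<open>A bound independent of \<open>n\<close>: below zero the value is explicit, above
    zero it grows from its value \<open>c\<close> at zero by at most the modulus; the final 1
    absorbs \<open>\<delta> n\<close>.\<close>
  have bound: "\<bar>y\<bar> \<le> \<bar>c\<bar> + \<bar>\<theta>\<bar> + \<bar>modulus \<theta>\<bar> + 1"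
    if "\<theta> \<le> 0 \<Longrightarrow> y = c + \<theta>" "0 \<le> \<theta> \<Longrightarrow> c \<le> y" "0 \<le> \<theta> \<Longrightarrow> y - c \<le> modulus \<theta> - modulus (0 - \<delta> n)"
    for y c \<theta> n
    using that modulus_neg[of "0 - \<delta> n"] \<delta>_pos[of n] \<delta>_le[of n] by (cases "0 \<le> \<theta>") auto
  obtain F1 l where F1: "F1 \<le> sequentially" "F1 \<noteq> bot"
    and l': "\<And>i. i \<in> pverts G \<times> UNIV \<Longrightarrow> ((\<lambda>n. ln n (fst i) (snd i)) \<longlongrightarrow> l i) F1"
  proof (rule pointwise_bounded_cluster[of sequentially "pverts G \<times> UNIV" "\<lambda>n i. ln n (fst i) (snd i)"])
    fix i assume "i \<in> pverts G \<times> (UNIV :: real set)"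
    then have v: "fst i \<in> pverts G" by auto
    have "\<bar>ln n (fst i) (snd i)\<bar> \<le> \<bar>free_label (fst i)\<bar> + \<bar>snd i\<bar> + \<bar>modulus (snd i)\<bar> + 1" for n
      using approx_solution.l_neg[OF app v, of 0 n] approx_solution.l_neg[OF app v, of "snd i" n]
        approx_solution.l_mono[OF app v, of 0 "snd i" n] approx_solution.l_growth[OF app v, of 0 "snd i" n]
      by (intro bound[of _ _ _ n]) auto
    then show "\<exists>B. \<forall>n. \<bar>ln n (fst i) (snd i)\<bar> \<le> B" by blast
  qed auto
  obtain F2 q where F2: "F2 \<le> F1" "F2 \<noteq> bot"
    and q': "\<And>i. i \<in> parcs G \<times> UNIV \<Longrightarrow> ((\<lambda>n. qn n (fst i) (snd i)) \<longlongrightarrow> q i) F2"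
  proof (rule pointwise_bounded_cluster[of F1 "parcs G \<times> UNIV" "\<lambda>n i. qn n (fst i) (snd i)"])
    fix i assume "i \<in> parcs G \<times> (UNIV :: real set)"
    then have e: "fst i \<in> parcs G" by auto
    have "\<bar>qn n (fst i) (snd i)\<bar> \<le> \<bar>free_label (fst (fst i)) + \<tau> (fst i)\<bar> + \<bar>snd i\<bar> + \<bar>modulus (snd i)\<bar> + 1" for n
      using approx_solution.q_neg[OF app e, of 0 n] approx_solution.q_neg[OF app e, of "snd i" n]
        approx_solution.q_mono[OF app e, of 0 "snd i" n] approx_solution.q_growth[OF app e, of 0 "snd i" n]
      by (intro bound[of _ _ _ n]) auto
    then show "\<exists>B. \<forall>n. \<bar>qn n (fst i) (snd i)\<bar> \<le> B" by blast
  qed (use F1 in auto)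
  obtain F x where F3: "F \<le> F2" "F \<noteq> bot"
    and x': "\<And>i. i \<in> parcs G \<times> UNIV \<Longrightarrow> ((\<lambda>n. xn n (fst i) (snd i)) \<longlongrightarrow> x i) F"
  proof (rule pointwise_bounded_cluster[of F2 "parcs G \<times> UNIV" "\<lambda>n i. xn n (fst i) (snd i)"])
    fix i assume "i \<in> parcs G \<times> (UNIV :: real set)"
    then have e: "fst i \<in> parcs G" by auto
    have "\<bar>xn n (fst i) (snd i)\<bar> \<le> \<bar>W (snd i)\<bar>" for n
      using approx_solution.x_neg[OF app e, of 0 n] approx_solution.x_neg[OF app e, of "snd i" n]
        approx_solution.x_mono[OF app e, of 0 "snd i" n] approx_solution.x_growth[OF app e, of 0 "snd i" n]
        inflow_neg[of "0 - \<delta> n"] \<delta>_pos[of n]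
      by (cases "0 \<le> snd i") auto
    then show "\<exists>B. \<forall>n. \<bar>xn n (fst i) (snd i)\<bar> \<le> B" by blast
  qed (use F2 in auto)
  have l: "((\<lambda>n. ln n v \<theta>) \<longlongrightarrow> l (v, \<theta>)) F" if "v \<in> pverts G" for v \<theta>
    using l'[of "(v, \<theta>)"] that F3(1) F2(1) by (auto elim: tendsto_mono[rotated])
  have q: "((\<lambda>n. qn n e \<theta>) \<longlongrightarrow> q (e, \<theta>)) F" if "e \<in> parcs G" for e \<theta>
    using q'[of "(e, \<theta>)"] that F3(1) by (auto elim: tendsto_mono[rotated])
  have x: "((\<lambda>n. xn n e \<theta>) \<longlongrightarrow> x (e, \<theta>)) F" if "e \<in> parcs G" for e \<theta>
    using x'[of "(e, \<theta>)"] that by simp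
  have \<delta>: "(\<delta> \<longlongrightarrow> 0) F"
    unfolding \<delta>_def[abs_def]
    by (rule tendsto_mono[OF _ LIMSEQ_inverse_real_of_nat]) (use F1 F2 F3 in auto)
  have W: "((\<lambda>n. W (y - \<delta> n)) \<longlongrightarrow> W (y - 0)) F" for y
    using \<delta> by (intro isCont_tendsto_compose[OF inflow_cont] tendsto_intros)
  have M: "((\<lambda>n. modulus (y - \<delta> n)) \<longlongrightarrow> modulus (y - 0)) F" for y
    using \<delta> by (intro isCont_tendsto_compose[OF modulus_cont] tendsto_intros)
  have sub: "\<exists>F' \<sigma>0. F' \<le> F \<and> F' \<noteq> bot \<and> (\<sigma> \<longlongrightarrow> \<sigma>0) F'" if "\<And>n. \<bar>\<sigma> n\<bar> \<le> B" for \<sigma> :: "nat \<Rightarrow> real" and B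
  proof -
    have "\<exists>B. \<forall>n. \<bar>\<sigma> n\<bar> \<le> B" using that by blast
    then obtain F' g where "F' \<le> F" "F' \<noteq> bot"
      "\<And>i. i \<in> (UNIV :: unit set) \<Longrightarrow> (\<sigma> \<longlongrightarrow> g i) F'"
      by (rule pointwise_bounded_cluster[OF F3(2), of "UNIV :: unit set" "\<lambda>n _. \<sigma> n"]) (rule that)
    then show ?thesis by (intro exI[of _ F'] exI[of _ "g ()"]) simp
  qed
  have le: "a \<le> b" if "(f \<longlongrightarrow> a) F" "(g \<longlongrightarrow> b) F" "\<And>n. f n \<le> g n" for f g :: "nat \<Rightarrow> real" and a b
    using tendsto_le[OF F3(2) that(2,1)] that(3) by simp
  have out: "e \<in> out_arcs (with_proj G) v \<Longrightarrow> e \<in> parcs G" "e \<in> in_arcs (with_proj G) v \<Longrightarrow> e \<in> parcs G" for e v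
    by auto
  have "approx_solution G \<nu> s t \<tau> W 0 (\<lambda>v \<theta>. l (v, \<theta>)) (\<lambda>e \<theta>. q (e, \<theta>)) (\<lambda>e \<theta>. x (e, \<theta>))"
  proof (unfold_locales, goal_cases)
    case (1 v a b)
    show ?case by (rule le[OF l l appD(1)]) (use 1 in auto)
  next
    case (2 v a b)
    show ?case
      by (rule le[OF tendsto_diff[OF l l] tendsto_diff[OF tendsto_const M] appD(2)]) (use 2 in auto)
  next
    case (3 e a b)
    show ?case by (rule le[OF q q appD(3)]) (use 3 in auto)
  next
    case (4 e a b)
    show ?case
      by (rule le[OF tendsto_diff[OF q q] tendsto_diff[OF tendsto_const M] appD(4)]) (use 4 in auto)
  next
    case (5 \<theta>)
    have "((\<lambda>n. \<theta> - \<delta> n) \<longlongrightarrow> \<theta> - 0) F" using \<delta> by (intro tendsto_intros)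
    then show ?case
      using le[OF _ l[OF source_in_verts]] le[OF l[OF source_in_verts] tendsto_const]
        approx_solution.l_source[OF app] by blast
  next
    case (6 e \<theta>)
    show ?case
      by (rule le[OF l q approx_solution.l_le_q[OF app]]) (use 6 arc_ends_in_verts in auto)
  next
    case (7 w \<theta>)
    show ?case
    proof (rule ccontr)
      assume *: "\<not> ?thesis"
      \<comment> \<open>If every arc into \<open>w\<close> were strictly late in the limit, finitely
        many strict inequalities would hold at once for some approximation, against its tight
        arc.\<close>
      have "\<forall>\<^sub>F n in F. ln n w \<theta> < qn n e \<theta>" if "e \<in> {e \<in> parcs G. snd e = w}" for e
        using * that 7 
        by (intro tendsto_eventually_less[OF l q]) auto
      then have "\<forall>\<^sub>F n in F. \<forall>e\<in>{e \<in> parcs G. snd e = w}. ln n w \<theta> < qn n e \<theta>"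
        by (intro eventually_ball_finite) auto
      then obtain n where "\<forall>e\<in>{e \<in> parcs G. snd e = w}. ln n w \<theta> < qn n e \<theta>"
        using F3(2) eventually_happens by blast
      then show False
        using approx_solution.l_tight[OF app 7, of n \<theta>] by fastforce
    qed
  next
    case (8 e \<theta>)
    show ?case
      by (rule le[OF tendsto_add[OF l tendsto_const] q approx_solution.q_ge[OF app]])
        (use 8 arc_ends_in_verts in auto)
  next
    case (9 e a b)
    show ?case
      by (rule le[OF tendsto_diff[OF x x] tendsto_mult[OF tendsto_const tendsto_diff[OF q q]] approx_solution.capacity[OF app]])
        (use 9 in auto)
  next
    case (10 e \<theta>)
    then obtain \<sigma> where \<sigma>: "\<And>n. \<sigma> n \<in> {min 0 \<theta>..\<theta>}"
      "\<And>n. \<nu> e * (qn n e \<theta> - \<tau> e - ln n (fst e) (\<sigma> n)) \<le> xn n e \<theta> - xn n e (\<sigma> n)"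
      using approx_solution.queue[OF app] by metis
    have "\<bar>\<sigma> n\<bar> \<le> \<bar>\<theta>\<bar>" for n using \<sigma>(1)[of n] by auto
    from sub[of \<sigma>, OF this] obtain F' \<sigma>0 where F': "F' \<le> F" "F' \<noteq> bot" "(\<sigma> \<longlongrightarrow> \<sigma>0) F'"
      by (elim exE conjE)
    have fe: "fst e \<in> pverts G" using 10 arc_ends_in_verts by blast
    have "((\<lambda>n. ln n (fst e) (\<sigma> n)) \<longlongrightarrow> l (fst e, \<sigma>0)) F'"
      by (rule tendsto_along_modulus[OF appD(1)[OF fe] appD(2)[OF fe] modulus_cont
            tendsto_mono[OF F'(1) \<delta>] F'(3) tendsto_mono[OF F'(1) l[OF fe]]])
    moreover have "((\<lambda>n. xn n e (\<sigma> n)) \<longlongrightarrow> x (e, \<sigma>0)) F'"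
      by (rule tendsto_along_modulus[OF appD(5)[OF 10] appD(6)[OF 10] inflow_cont
            tendsto_mono[OF F'(1) \<delta>] F'(3) tendsto_mono[OF F'(1) x[OF 10]]])
    ultimately have "\<nu> e * (q (e, \<theta>) - \<tau> e - l (fst e, \<sigma>0)) \<le> x (e, \<theta>) - x (e, \<sigma>0)"
      using \<sigma>(2)
      by (intro tendsto_le[OF F'(2) tendsto_diff[OF tendsto_mono[OF F'(1) x[OF 10]]]
            tendsto_mult[OF tendsto_const tendsto_diff[OF tendsto_diff[OF tendsto_mono[OF F'(1) q[OF 10]] tendsto_const]]]]) auto
    moreover have "\<sigma>0 \<in> {min 0 \<theta>..\<theta>}"
      by (rule Lim_in_closed_set[OF _ _ F'(2,3)]) (use \<sigma>(1) in auto)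
    ultimately show ?case by blast
  next
    case (11 e a b)
    have ne: "\<forall>\<^sub>F n in F. xn n e b - xn n e a \<noteq> 0"
      using tendsto_diff[OF x[OF 11(1)] x[OF 11(1)], of b a] 11(3) by (intro tendsto_imp_eventually_ne) auto
    \<comment> \<open>\<open>b\<close> is a dummy witness for those \<open>n\<close> at which
      nothing enters \<open>e\<close> between \<open>a\<close> and \<open>b\<close>; by
      \<open>ne\<close> there are eventually none along \<open>F\<close>.\<close>
    have "\<exists>\<sigma>. \<sigma> \<in> {a - \<delta> n..b} \<and> (xn n e b - xn n e a \<noteq> 0 \<longrightarrow> qn n e \<sigma> \<le> ln n (snd e) \<sigma>)" for n
      using approx_solution.active[OF app 11(1,2), of n] 11(2) \<delta>_pos[of n]
      by (cases "xn n e b - xn n e a = 0") (auto intro: exI[of _ b])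
    then obtain \<sigma> where \<sigma>: "\<And>n. \<sigma> n \<in> {a - \<delta> n..b}"
      "\<And>n. xn n e b - xn n e a \<noteq> 0 \<Longrightarrow> qn n e (\<sigma> n) \<le> ln n (snd e) (\<sigma> n)"
      by metis
    have "\<bar>\<sigma> n\<bar> \<le> \<bar>a\<bar> + \<bar>b\<bar> + 1" for n using \<sigma>(1)[of n] \<delta>_pos[of n] \<delta>_le[of n] by auto
    from sub[of \<sigma>, OF this] obtain F' \<sigma>0 where F': "F' \<le> F" "F' \<noteq> bot" "(\<sigma> \<longlongrightarrow> \<sigma>0) F'"
      by (elim exE conjE)
    have se: "snd e \<in> pverts G" using 11 arc_ends_in_verts by blast
    have "((\<lambda>n. ln n (snd e) (\<sigma> n)) \<longlongrightarrow> l (snd e, \<sigma>0)) F'"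
      by (rule tendsto_along_modulus[OF appD(1)[OF se] appD(2)[OF se] modulus_cont
            tendsto_mono[OF F'(1) \<delta>] F'(3) tendsto_mono[OF F'(1) l[OF se]]])
    moreover have "((\<lambda>n. qn n e (\<sigma> n)) \<longlongrightarrow> q (e, \<sigma>0)) F'"
      by (rule tendsto_along_modulus[OF appD(3)[OF 11(1)] appD(4)[OF 11(1)] modulus_cont
            tendsto_mono[OF F'(1) \<delta>] F'(3) tendsto_mono[OF F'(1) q[OF 11(1)]]])
    moreover have "\<forall>\<^sub>F n in F'. qn n e (\<sigma> n) \<le> ln n (snd e) (\<sigma> n)"
      using filter_leD[OF F'(1) ne] by eventually_elim (rule \<sigma>(2))
    ultimately have "q (e, \<sigma>0) \<le> l (snd e, \<sigma>0)"
      by (intro tendsto_le[OF F'(2)])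
    moreover have "\<sigma>0 \<le> b"
      using \<sigma>(1) by (intro tendsto_le[OF F'(2) tendsto_const F'(3)]) auto
    moreover have "a - 0 \<le> \<sigma>0"
      using \<sigma>(1) by (intro tendsto_le[OF F'(2) F'(3) tendsto_diff[OF tendsto_const tendsto_mono[OF F'(1) \<delta>]]]) auto
    ultimately show ?case by auto
  next
    case (12 v \<theta>)
    have "((\<lambda>n. \<Sum>e\<in>out_arcs (with_proj G) v. xn n e \<theta>) \<longlongrightarrow> (\<Sum>e\<in>out_arcs (with_proj G) v. x (e, \<theta>))) F"
      by (intro tendsto_sum x out)
    moreover have "((\<lambda>n. \<Sum>e\<in>out_arcs (with_proj G) v. xn n e \<theta>) \<longlongrightarrow> (\<Sum>e\<in>in_arcs (with_proj G) v. x (e, \<theta>))) F"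
      unfolding approx_solution.conservation[OF app 12] by (intro tendsto_sum x out)
    ultimately show ?case using F3(2) tendsto_unique by blast
  next
    case (13 \<theta>)
    have "((\<lambda>n. (\<Sum>e\<in>out_arcs (with_proj G) s. xn n e \<theta>) - (\<Sum>e\<in>in_arcs (with_proj G) s. xn n e \<theta>))
      \<longlongrightarrow> (\<Sum>e\<in>out_arcs (with_proj G) s. x (e, \<theta>)) - (\<Sum>e\<in>in_arcs (with_proj G) s. x (e, \<theta>))) F"
      by (intro tendsto_diff tendsto_sum x out)
    from le[OF W this] le[OF this tendsto_const] show ?case
      using approx_solution.conservation_source[OF app] by blast
  next
    case (14 e a b)
    show ?case by (rule le[OF x x appD(5)]) (use 14 in auto)
  next
    case (15 e a b)
    show ?case
      by (rule le[OF tendsto_diff[OF x x] tendsto_diff[OF tendsto_const W] appD(6)]) (use 15 in auto)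
  next
    case (16 e \<theta>)
    then show ?case
      using x[OF 16(1), of \<theta>] F3(2) by (simp add: approx_solution.x_neg[OF app 16] tendsto_const_iff)
  next
    case (17 e \<theta>)
    then show ?case
      using x[OF 17(1), of \<theta>] F3(2) by (simp add: approx_solution.x_sink[OF app 17] tendsto_const_iff)
  next
    case (18 v \<theta>)
    then show ?case
      using l[OF 18(1), of \<theta>] F3(2) by (simp add: approx_solution.l_neg[OF app 18] tendsto_const_iff)
  next
    case (19 e \<theta>)
    then show ?case
      using q[OF 19(1), of \<theta>] F3(2) by (simp add: approx_solution.q_neg[OF app 19] tendsto_const_iff)
  qed
  then show ?thesis by blast
qed

end

section \<open>Flows from exact solutions\<close>

lemma IVT_obtain:
  fixes f :: "real \<Rightarrow> real"
  assumes "\<And>x. isCont f x" "f a \<le> y" "y \<le> f b" "a \<le> b"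
  obtains c where "a \<le> c" "c \<le> b" "f c = y"
  using IVT[of f a y b] assms by blast

locale exact_solution = approx_solution G \<nu> s t \<tau> W 0 l q x
  for G :: "'v pair_pre_digraph" and \<nu> and s t :: 'v and \<tau> W
    and l :: "'v \<Rightarrow> real \<Rightarrow> real" and q x :: "'v \<times> 'v \<Rightarrow> real \<Rightarrow> real"
begin

section \<open>Continuity and Lipschitz bounds for exact solutions\<close>

lemma l_cont: "v \<in> pverts G \<Longrightarrow> isCont (l v) \<theta>"
  by (rule isCont_dominated_increments[OF l_mono _ modulus_cont]) (use l_growth in auto)

lemma q_cont: "e \<in> parcs G \<Longrightarrow> isCont (q e) \<theta>"
  by (rule isCont_dominated_increments[OF q_mono _ modulus_cont]) (use q_growth in auto)

lemma x_cont: "e \<in> parcs G \<Longrightarrow> isCont (x e) \<theta>"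
  by (rule isCont_dominated_increments[OF x_mono _ inflow_cont]) (use x_growth in auto)

lemma l_s [simp]: "l s \<theta> = \<theta>"
  using l_source[of \<theta>] by simp

text \<open>Travel times are positive, so the constant \<open>\<theta>\<close> is a subsolution of
  the Bellman system.\<close>

lemma l_ge:
  assumes "v \<in> pverts G"
  shows "\<theta> \<le> l v \<theta>"
proof (rule label_queued_greatest[of "\<lambda>e. q e \<theta>" \<theta> "\<lambda>v. l v \<theta>" "\<lambda>_. \<theta>", OF _ _ _ assms])
  show "label_solution (queued (\<lambda>e. q e \<theta>)) \<theta> (\<lambda>v. l v \<theta>)"
    unfolding label_solution_def
  proof (intro conjI ballI)
    fix e assume "e \<in> parcs G"
    then show "l (snd e) \<theta> \<le> queued (\<lambda>e. q e \<theta>) e (l (fst e) \<theta>)"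
      using l_le_q[of e \<theta>] by simp
  next
    fix w assume "w \<in> pverts G - {s}"
    from l_tight[OF this, of \<theta>] show "\<exists>e\<in>parcs G. snd e = w \<and> queued (\<lambda>e. q e \<theta>) e (l (fst e) \<theta>) \<le> l w \<theta>"
      using q_ge by (metis max.bounded_iff order_trans)
  qed simp
  fix e assume "e \<in> parcs G"
  then show "\<theta> \<le> queued (\<lambda>e. q e \<theta>) e \<theta>"
    using travel_time_pos[of e] by simp
qed simp

text \<open>The condition \<open>active\<close> concerns closed intervals, whereas here the
  endpoints may be active. An increase of \<open>x e\<close> would already occur between the
  interior points at which one third and two thirds of it are reached.\<close>

lemma constant_if_inactive:
  assumes e: "e \<in> parcs G" and ab: "a \<le> b"
    and inactive: "\<And>\<sigma>. a < \<sigma> \<Longrightarrow> \<sigma> < b \<Longrightarrow> l (snd e) \<sigma> < q e \<sigma>"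
  shows "x e a = x e b"
proof (rule ccontr)
  assume "x e a \<noteq> x e b"
  then have lt: "x e a < x e b" using x_mono[OF e ab] by simp
  obtain c where c: "a \<le> c" "c \<le> b" "x e c = (2 * x e a + x e b) / 3"
    by (rule IVT_obtain[of "x e" a "(2 * x e a + x e b) / 3" b]) (use x_cont[OF e] lt ab in auto)
  obtain d where d: "c \<le> d" "d \<le> b" "x e d = (x e a + 2 * x e b) / 3"
    by (rule IVT_obtain[of "x e" c "(x e a + 2 * x e b) / 3" b]) (use x_cont[OF e] lt c in auto)
  have "a \<noteq> c" "d \<noteq> b"
    using c(3) d(3) lt by auto
  moreover obtain \<sigma> where "\<sigma> \<in> {c - 0..d}" "q e \<sigma> \<le> l (snd e) \<sigma>"
    using active[OF e d(1)] c(3) d(3) lt by auto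
  ultimately show False
    using inactive[of \<sigma>] c d by auto
qed

text \<open>The active times in \<open>{a..b}\<close> form a nonempty compact set, and before its
  minimum and after its maximum \<open>x e\<close> is constant.\<close>

lemma first_last_active:
  assumes e: "e \<in> parcs G" and ab: "a \<le> b" and ne: "x e a \<noteq> x e b"
  obtains \<sigma> \<rho> where "a \<le> \<sigma>" "\<sigma> \<le> \<rho>" "\<rho> \<le> b" "x e \<sigma> = x e a" "x e \<rho> = x e b"
    "q e \<sigma> \<le> l (snd e) \<sigma>" "q e \<rho> \<le> l (snd e) \<rho>"
proof -
  define S where "S = {\<sigma>. q e \<sigma> \<le> l (snd e) \<sigma>} \<inter> {a..b}"
  have "closed {\<sigma>. q e \<sigma> \<le> l (snd e) \<sigma>}"
    using q_cont[OF e] l_cont arc_ends_in_verts[OF e]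
    by (intro closed_Collect_le continuous_at_imp_continuous_on) auto
  then have closed: "closed S" unfolding S_def by (intro closed_Int) auto
  have nonempty: "S \<noteq> {}"
    using active[OF e ab ne] unfolding S_def by auto
  have bdd: "bdd_below S" "bdd_above S"
    by (auto simp: S_def)
  have inS: "Inf S \<in> S" "Sup S \<in> S"
    using closed_contains_Inf[OF nonempty bdd(1) closed] closed_contains_Sup[OF nonempty bdd(2) closed] by auto
  have low: "Inf S \<le> \<sigma>" and high: "\<sigma> \<le> Sup S" if "\<sigma> \<in> S" for \<sigma>
    using cInf_lower[OF that bdd(1)] cSup_upper[OF that bdd(2)] by auto
  have inactive: "l (snd e) \<sigma> < q e \<sigma>" if "\<sigma> \<notin> S" "a \<le> \<sigma>" "\<sigma> \<le> b" for \<sigma>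
    using that by (simp add: S_def not_le)
  have bounds: "a \<le> Inf S" "Inf S \<le> b" "a \<le> Sup S" "Sup S \<le> b"
    using inS by (auto simp: S_def)
  have "x e a = x e (Inf S)"
    by (rule constant_if_inactive[OF e bounds(1)], rule inactive) (use low in force, use bounds in auto)
  moreover have "x e (Sup S) = x e b"
    by (rule constant_if_inactive[OF e bounds(4)], rule inactive) (use high in force, use bounds in auto)
  ultimately show ?thesis
    using inS low[OF inS(2)] by (intro that[of "Inf S" "Sup S"]) (auto simp: S_def)
qed

text \<open>The exit time never precedes the head label and agrees with it at active times. Between
  the first and the last active time the capacity bound on exit times therefore becomes one on
  labels.\<close>

lemma x_lipschitz:
  assumes e: "e \<in> parcs G" and ab: "a \<le> b"
  shows "x e b - x e a \<le> \<nu> e * (l (snd e) b - l (snd e) a)"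
proof (cases "x e a = x e b")
  case True
  then show ?thesis
    using l_mono[OF _ ab] arc_ends_in_verts[OF e] service_rate_pos[OF e] by simp
next
  case False
  then obtain \<sigma> \<rho> where *: "a \<le> \<sigma>" "\<sigma> \<le> \<rho>" "\<rho> \<le> b" "x e \<sigma> = x e a" "x e \<rho> = x e b"
    "q e \<rho> \<le> l (snd e) \<rho>"
    by (rule first_last_active[OF e ab])
  have w: "snd e \<in> pverts G" using arc_ends_in_verts[OF e] by simp
  have "x e b - x e a \<le> \<nu> e * (q e \<rho> - q e \<sigma>)"
    using capacity[OF e *(2)] *(4,5) by simp
  also have "\<dots> \<le> \<nu> e * (l (snd e) b - l (snd e) a)"
    using *(6) l_le_q[OF e, of \<sigma>] l_mono[OF w *(1)] l_mono[OF w *(3)] service_rate_pos[OF e]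
    by (intro mult_left_mono) auto
  finally show ?thesis .
qed

text \<open>Departing at \<open>a\<close> and using \<open>e\<close> gives the same arrival at the
  head as an earliest arrival when departing at \<open>\<rho>\<close>. If
  \<open>\<rho> \<le> a\<close>, the head label is constant between them; otherwise the exit time is
  constant from \<open>a\<close> to the last active time. In both cases no flow enters.\<close>

lemma x_eq_if_exit_eq:
  assumes e: "e \<in> parcs G" and eq: "q e a = l (snd e) \<rho>"
  shows "x e a = x e \<rho>"
proof (cases "\<rho> \<le> a")
  case True
  have "l (snd e) a \<le> l (snd e) \<rho>"
    using l_le_q[OF e, of a] eq by simp
  then have "\<nu> e * (l (snd e) a - l (snd e) \<rho>) \<le> 0"
    using service_rate_pos[OF e] by (simp add: mult_le_0_iff)
  then show ?thesis
    using x_lipschitz[OF e True] x_mono[OF e True] by simp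
next
  case False
  then have le: "a \<le> \<rho>" by simp
  show ?thesis
  proof (rule ccontr)
    assume ne: "x e a \<noteq> x e \<rho>"
    then obtain \<sigma> where *: "a \<le> \<sigma>" "\<sigma> \<le> \<rho>" "x e \<sigma> = x e \<rho>" "q e \<sigma> \<le> l (snd e) \<sigma>"
      using first_last_active[OF e le ne] by (metis order_trans)
    have "q e \<sigma> \<le> q e a"
      using *(4) l_mono[OF _ *(2)] arc_ends_in_verts[OF e] eq by fastforce
    then have "\<nu> e * (q e \<sigma> - q e a) \<le> 0"
      using service_rate_pos[OF e] by (simp add: mult_le_0_iff)
    then show False
      using capacity[OF e *(1)] x_mono[OF e le] *(3) ne by simp
  qed
qed

text \<open>At an intermediate node, what enters \<open>e\<close> has arrived through the incoming
  arcs, each controlled by the label at its head; from the sink nothing leaves.\<close>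

lemma x_lipschitz_tail:
  assumes e: "e \<in> parcs G" and ab: "a \<le> b" and ne: "fst e \<noteq> s"
  shows "x e b - x e a \<le> (\<Sum>e\<in>parcs G. \<nu> e) * (l (fst e) b - l (fst e) a)"
proof (cases "fst e = t")
  case True
  then show ?thesis
    using x_sink[OF e True] l_mono[OF _ ab] arc_ends_in_verts[OF e] service_rate_pos
    by (simp add: sum_nonneg less_imp_le)
next
  case False
  let ?v = "fst e"
  have v: "?v \<in> pverts G - {s, t}" using False ne arc_ends_in_verts[OF e] by simp
  have e_out: "e \<in> out_arcs (with_proj G) ?v" using e by simp
  have "x e b - x e a \<le> (\<Sum>e\<in>out_arcs (with_proj G) ?v. x e b - x e a)"
    by (rule member_le_sum[OF e_out]) (use x_mono[OF _ ab] finite_out_arcs in auto)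
  also have "\<dots> = (\<Sum>e\<in>in_arcs (with_proj G) ?v. x e b - x e a)"
    by (simp add: sum_subtractf conservation[OF v])
  also have "\<dots> \<le> (\<Sum>e'\<in>in_arcs (with_proj G) ?v. \<nu> e' * (l ?v b - l ?v a))"
    using x_lipschitz[OF _ ab] by (intro sum_mono) force
  also have "\<dots> \<le> (\<Sum>e'\<in>parcs G. \<nu> e' * (l ?v b - l ?v a))"
    using service_rate_pos l_mono[OF _ ab, of ?v] v
    by (intro sum_mono2) (auto simp: less_imp_le)
  finally show ?thesis
    by (simp add: sum_distrib_right)
qed

section \<open>Change of variables from departure times to clock times\<close>

lemma label_attained:
  assumes v: "v \<in> pverts G"
  shows "\<exists>\<theta>. l v \<theta> = y"
proof -
  \<comment> \<open>Below zero the label is explicit and unbounded from below; above, it dominates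
    the departure time.\<close>
  let ?a = "min 0 (y - free_label v)"
  have "l v ?a \<le> y"
    using l_neg[OF v, of ?a] by auto
  moreover have "y \<le> l v (max ?a y)"
    using l_ge[OF v, of "max ?a y"] by simp
  ultimately obtain c where "l v c = y"
    by (rule IVT_obtain[of "l v", OF l_cont[OF v]]) auto
  then show ?thesis ..
qed

text \<open>A right inverse of \<open>l v\<close>. The choice of preimage is immaterial for the
  flow, as \<open>x e\<close> is constant on the level sets of the labels at both ends of
  \<open>e\<close>.\<close>

definition departure :: "'v \<Rightarrow> real \<Rightarrow> real" where
  "departure v y = (SOME \<theta>. l v \<theta> = y)"

lemma l_departure: "v \<in> pverts G \<Longrightarrow> l v (departure v y) = y"
  unfolding departure_def using label_attained by (rule someI_ex)

lemma departure_mono: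
  assumes "v \<in> pverts G" "a \<le> b"
  shows "departure v a \<le> departure v b"
proof (cases "a = b")
  case False
  show ?thesis
  proof (rule ccontr)
    assume "\<not> ?thesis"
    then show False
      using l_mono[OF assms(1), of "departure v b" "departure v a"] assms False
      by (simp add: l_departure)
  qed
qed simp

lemma departure_s [simp]: "departure s y = y"
  using l_departure[OF source_in_verts, of y] by simp

definition cum_in :: "'v \<times> 'v \<Rightarrow> real \<Rightarrow> real" where
  "cum_in e y = x e (departure (fst e) y)"

definition cum_out :: "'v \<times> 'v \<Rightarrow> real \<Rightarrow> real" where
  "cum_out e y = x e (departure (snd e) y)"

lemma cum_mono:
  assumes "e \<in> parcs G" "a \<le> b"
  shows "cum_in e a \<le> cum_in e b" "cum_out e a \<le> cum_out e b"
  unfolding cum_in_def cum_out_def using assms arc_ends_in_verts[OF assms(1)] departure_mono x_mono by auto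

lemma cum_neg:
  assumes e: "e \<in> parcs G" and y: "y \<le> 0"
  shows "cum_in e y = 0" "cum_out e y = 0"
proof -
  have "departure v y \<le> 0" if "v \<in> pverts G" for v
    using l_ge[OF that, of "departure v y"] l_departure[OF that, of y] y by simp
  then show "cum_in e y = 0" "cum_out e y = 0"
    using x_neg[OF e] arc_ends_in_verts[OF e] by (auto simp: cum_in_def cum_out_def)
qed

lemma cum_out_lipschitz:
  assumes e: "e \<in> parcs G" and ab: "a \<le> b"
  shows "cum_out e b - cum_out e a \<le> \<nu> e * (b - a)"
  using x_lipschitz[OF e departure_mono[OF _ ab], of "snd e"] arc_ends_in_verts[OF e]
  by (simp add: cum_out_def l_departure)

text \<open>One dominating function serves all tails: \<open>W\<close> at the source, the total
  service rate elsewhere. It has a density whenever \<open>W\<close> has one.\<close>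

lemma cum_in_growth:
  assumes e: "e \<in> parcs G" and ab: "a \<le> b"
  shows "cum_in e b - cum_in e a \<le> (W b + (\<Sum>e\<in>parcs G. \<nu> e) * b) - (W a + (\<Sum>e\<in>parcs G. \<nu> e) * a)"
proof -
  have "0 \<le> (\<Sum>e\<in>parcs G. \<nu> e) * (b - a)"
    using ab service_rate_pos by (intro mult_nonneg_nonneg sum_nonneg) (auto simp: less_imp_le)
  then have nn: "0 \<le> (\<Sum>e\<in>parcs G. \<nu> e) * b - (\<Sum>e\<in>parcs G. \<nu> e) * a"
    by (simp add: right_diff_distrib)
  show ?thesis
  proof (cases "fst e = s")
    case True
    then show ?thesis
      using x_growth[OF e ab] nn by (simp add: cum_in_def)
  next
    case False
    show ?thesis
      using x_lipschitz_tail[OF e departure_mono[OF _ ab] False, of "fst e"] arc_ends_in_verts[OF e]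
        monoD[OF inflow_mono ab] by (simp add: cum_in_def l_departure right_diff_distrib)
  qed
qed

lemma cum_in_label:
  assumes e: "e \<in> parcs G"
  shows "cum_in e (l (fst e) \<theta>) = x e \<theta>"
proof (cases "fst e = s")
  case False
  have v: "fst e \<in> pverts G" using arc_ends_in_verts[OF e] by simp
  let ?d = "departure (fst e) (l (fst e) \<theta>)"
  have eq: "l (fst e) ?d = l (fst e) \<theta>" by (rule l_departure[OF v])
  show ?thesis
  proof (cases "?d \<le> \<theta>")
    case True
    then show ?thesis
      using x_lipschitz_tail[OF e True False] x_mono[OF e True] eq by (simp add: cum_in_def)
  next
    case d: False
    then have "\<theta> \<le> ?d" by simp
    then show ?thesis
      using x_lipschitz_tail[OF e _ False, of \<theta> ?d] x_mono[OF e, of \<theta> ?d] eq by (simp add: cum_in_def)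
  qed
qed (simp add: cum_in_def)

lemma cum_out_exit:
  assumes e: "e \<in> parcs G"
  shows "cum_out e (q e \<theta>) = x e \<theta>"
  unfolding cum_out_def
  using x_eq_if_exit_eq[OF e, of \<theta> "departure (snd e) (q e \<theta>)"] l_departure arc_ends_in_verts[OF e] by simp

text \<open>Going back from \<^term>\<open>\<theta>\<close> to the start of the current busy period of the queue, the arc
  has been working at full rate, so the queue found on entering is exactly what it still has to
  serve.\<close>

lemma queue_eq:
  assumes e: "e \<in> parcs G"
  shows "x e \<theta> - cum_out e (l (fst e) \<theta> + \<tau> e) = \<nu> e * (q e \<theta> - (l (fst e) \<theta> + \<tau> e))"
proof -
  have v: "fst e \<in> pverts G" using arc_ends_in_verts[OF e] by simp
  note pos = service_rate_pos[OF e]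
  obtain \<sigma> where \<sigma>: "\<sigma> \<le> \<theta>" "\<nu> e * (q e \<theta> - \<tau> e - l (fst e) \<sigma>) \<le> x e \<theta> - x e \<sigma>"
    using queue[OF e, of \<theta>] by auto
  have "\<nu> e * (q e \<theta> - \<tau> e - l (fst e) \<sigma>) \<le> \<nu> e * (q e \<theta> - q e \<sigma>)"
    using \<sigma>(2) capacity[OF e \<sigma>(1)] by linarith
  then have "q e \<sigma> \<le> l (fst e) \<sigma> + \<tau> e"
    using pos by simp
  then have q\<sigma>: "q e \<sigma> = l (fst e) \<sigma> + \<tau> e"
    using q_ge[OF e, of \<sigma>] by simp
  then have "q e \<sigma> \<le> l (fst e) \<theta> + \<tau> e"
    using l_mono[OF v \<sigma>(1)] by simp
  \<comment> \<open>\<open>a\<close> is a departure time whose flow exits \<open>e\<close> at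
    \<open>l (fst e) \<theta> + \<tau> e\<close>. The capacity bound is attained from
    \<open>\<sigma>\<close> to \<open>\<theta>\<close>, hence also from \<open>a\<close> to
    \<open>\<theta>\<close>.\<close>
  then obtain a where a: "\<sigma> \<le> a" "a \<le> \<theta>" "q e a = l (fst e) \<theta> + \<tau> e"
    by (rule IVT_obtain[of "q e", OF q_cont[OF e] _ q_ge[OF e] \<sigma>(1)]) auto
  have "\<nu> e * (q e \<theta> - q e \<sigma>) \<le> x e \<theta> - x e \<sigma>"
    using \<sigma>(2) q\<sigma> by (simp add: algebra_simps)
  then have "x e \<theta> - x e a = \<nu> e * (q e \<theta> - q e a)"
    using capacity[OF e a(1)] capacity[OF e a(2)] by (simp add: algebra_simps)
  moreover have "cum_out e (q e a) = x e a"
    by (rule cum_out_exit[OF e])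
  ultimately show ?thesis
    using a(3) by simp
qed

end

section \<open>Densities as flow rates\<close>

lemma has_density_absolutely_integrable:
  assumes "has_density F f"
  shows "f absolutely_integrable_on {a..b}"
proof (cases "a \<le> b")
  case True
  then have "f integrable_on {a..b}"
    using has_densityD(3)[OF assms] by blast
  then show ?thesis
    by (rule nonnegative_absolutely_integrable_1) (rule has_densityD(2)[OF assms])
qed simp

lemma cumulative_eq_if_has_density:
  assumes f: "has_density F f"
  shows "cumulative f \<theta> = F \<theta> - F 0"
proof -
  have int: "set_lebesgue_integral lebesgue {a<..<b} f = F b - F a" if "a \<le> b" for a b
  proof -
    have "set_lebesgue_integral lebesgue {a<..<b} f = integral {a<..<b} f"
      using has_density_absolutely_integrable[OF f, of a b]
      by (intro set_lebesgue_integral_eq_integral(2)) (rule set_integrable_subset, auto)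
    also have "\<dots> = integral {a..b} f"
      using integral_open_interval_real[of a b f] by simp
    also have "\<dots> = F b - F a"
      by (rule integral_unique[OF has_densityD(3)[OF f that]])
    finally show ?thesis .
  qed
  have einterval: "einterval (ereal a) (ereal b) = {a<..<b}" for a b
    by (auto simp: einterval_def)
  show ?thesis
    using int[of 0 \<theta>] int[of \<theta> 0]
    by (auto simp: cumulative_def interval_lebesgue_integral_def zero_ereal_def einterval)
qed

lemma AE_atMost_if_AE_atLeastAtMost:
  assumes "\<And>n::nat. AE x in lborel. a - real n \<le> x \<and> x \<le> a \<longrightarrow> P x"
  shows "AE x::real in lborel. x \<le> a \<longrightarrow> P x"
proof -
  have "AE x in lborel. \<forall>n::nat. a - real n \<le> x \<and> x \<le> a \<longrightarrow> P x"
    unfolding AE_all_countable using assms by blast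
  then show ?thesis
  proof eventually_elim
    case (elim x)
    obtain n :: nat where "a - x \<le> real n" using real_arch_simple by blast
    then show ?case using elim by (auto simp: algebra_simps)
  qed
qed

lemma has_density_in_F0:
  assumes f: "has_density F f" and F: "\<And>x. x \<le> 0 \<Longrightarrow> F x = 0"
  shows "f \<in> F0"
proof -
  have "set_integrable lebesgue K f" if "compact K" for K
  proof -
    have "bounded K" using that by (rule compact_imp_bounded)
    then obtain a where "K \<subseteq> cbox (- a) a"
      using bounded_subset_cbox_symmetric by blast
    then show ?thesis
      using that by (intro set_integrable_subset[OF has_density_absolutely_integrable[OF f, of "- a" a]])
        (auto intro: fmeasurableD lmeasurable_compact)
  qed
  moreover have "AE x in lborel. x \<le> 0 \<longrightarrow> f x = 0"
  proof (rule AE_atMost_if_AE_atLeastAtMost)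
    fix n :: nat
    show "AE x in lborel. 0 - real n \<le> x \<and> x \<le> 0 \<longrightarrow> f x = 0"
      by (rule density_AE_eq_on[OF f has_density_cmult[OF order_refl]]) (simp add: F)
  qed
  then have "AE x in lebesgue. x < 0 \<longrightarrow> f x = 0"
    by (intro AE_completion) (auto elim: eventually_mono)
  ultimately show ?thesis
    using has_densityD(2)[OF f] by (simp add: F0_def locally_integrable_def)
qed

section \<open>Verification of the equilibrium conditions\<close>

locale exact_solution_density = exact_solution G \<nu> s t \<tau> W l q x
  for G :: "'v pair_pre_digraph" and \<nu> and s t :: 'v and \<tau> W
    and l :: "'v \<Rightarrow> real \<Rightarrow> real" and q x :: "'v \<times> 'v \<Rightarrow> real \<Rightarrow> real" +
  fixes u :: "real \<Rightarrow> real" and fp fm :: "'v \<times> 'v \<Rightarrow> real \<Rightarrow> real"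
  assumes inflow_density: "has_density W u"
    and in_density: "\<And>e. e \<in> parcs G \<Longrightarrow> has_density (cum_in e) (fp e)"
    and out_density: "\<And>e. e \<in> parcs G \<Longrightarrow> has_density (cum_out e) (fm e)"
begin

lemma queue_size_eq:
  assumes e: "e \<in> parcs G"
  shows "queue_size \<tau> (fp, fm) e y = cum_in e y - cum_out e (y + \<tau> e)"
  using cumulative_eq_if_has_density[OF in_density[OF e]] cumulative_eq_if_has_density[OF out_density[OF e]]
    cum_neg[OF e, of 0] by (simp add: queue_size_def)

lemma queue_size_label:
  assumes e: "e \<in> parcs G"
  shows "queue_size \<tau> (fp, fm) e (l (fst e) \<theta>) = \<nu> e * (q e \<theta> - (l (fst e) \<theta> + \<tau> e))"
  using queue_eq[OF e] by (simp add: queue_size_eq[OF e] cum_in_label[OF e])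

lemma exit_time_label:
  assumes e: "e \<in> parcs G"
  shows "exit_time \<nu> \<tau> (fp, fm) e (l (fst e) \<theta>) = q e \<theta>"
  using service_rate_pos[OF e] by (simp add: exit_time_def queue_size_label[OF e])

lemma exit_time_eq:
  assumes e: "e \<in> parcs G"
  shows "exit_time \<nu> \<tau> (fp, fm) e y = q e (departure (fst e) y)"
  using exit_time_label[OF e, of "departure (fst e) y"] arc_ends_in_verts[OF e] by (simp add: l_departure)

lemma queue_size_nonneg:
  assumes e: "e \<in> parcs G"
  shows "0 \<le> queue_size \<tau> (fp, fm) e y"
  using queue_size_label[OF e, of "departure (fst e) y"] q_ge[OF e, of "departure (fst e) y"]
    service_rate_pos[OF e] arc_ends_in_verts[OF e]
  by (simp add: l_departure)

text \<open>Both sides solve the Bellman system for the actual exit times of the flow. These are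
  nondecreasing and exceed the entry times, so the solution is unique.\<close>

lemma earliest_time_eq:
  assumes v: "v \<in> pverts G"
  shows "earliest_time G \<nu> \<tau> s (fp, fm) v \<theta> = l v \<theta>"
proof -
  let ?T = "exit_time \<nu> \<tau> (fp, fm)"
  have mono: "mono (?T e)" if e: "e \<in> parcs G" for e
    unfolding mono_def exit_time_eq[OF e]
    using q_mono[OF e] departure_mono arc_ends_in_verts[OF e] by blast
  have gt: "\<forall>e\<in>parcs G. \<forall>y. y < ?T e y"
    using queue_size_nonneg travel_time_pos service_rate_pos
    by (auto simp: exit_time_def intro!: add_nonneg_pos divide_nonneg_pos)
  have "label_solution ?T \<theta> (label ?T \<theta>)"
    using gt mono by (intro label_solution_label) (auto intro: less_imp_le)
  moreover have "label ?T \<theta> = (\<lambda>v. earliest_time G \<nu> \<tau> s (fp, fm) v \<theta>)"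
    by (simp add: label_def earliest_time_def path_exit_time_def fun_eq_iff)
  ultimately have L: "label_solution ?T \<theta> (\<lambda>v. earliest_time G \<nu> \<tau> s (fp, fm) v \<theta>)"
    by simp
  have l: "label_solution ?T \<theta> (\<lambda>v. l v \<theta>)"
    unfolding label_solution_def
  proof (intro conjI ballI)
    show "l (snd e) \<theta> \<le> ?T e (l (fst e) \<theta>)" if "e \<in> parcs G" for e
      using l_le_q[OF that] by (simp add: exit_time_label[OF that])
    show "\<exists>e\<in>parcs G. snd e = w \<and> ?T e (l (fst e) \<theta>) \<le> l w \<theta>" if "w \<in> pverts G - {s}" for w
      using l_tight[OF that, of \<theta>] exit_time_label by auto
  qed simp
  show ?thesis
  proof (rule antisym)
    show "earliest_time G \<nu> \<tau> s (fp, fm) v \<theta> \<le> l v \<theta>"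
      by (rule label_solution_greatest[OF l gt mono _ _ v]) (use L in \<open>auto simp: label_solution_def\<close>)
    show "l v \<theta> \<le> earliest_time G \<nu> \<tau> s (fp, fm) v \<theta>"
      by (rule label_solution_greatest[OF L gt mono _ _ v]) (use l in \<open>auto simp: label_solution_def\<close>)
  qed
qed

lemma outflow_le_rate:
  assumes e: "e \<in> parcs G"
  shows "AE y in lborel. fm e y \<le> \<nu> e"
  using service_rate_pos[OF e] cum_out_lipschitz[OF e]
  by (intro density_AE_le[OF out_density[OF e] has_density_cmult]) (auto simp: right_diff_distrib)

lemma flow_conservation:
  assumes v: "v \<in> pverts G - {t}"
  shows "AE y in lborel. (\<Sum>e\<in>out_arcs (with_proj G) v. fp e y) - (\<Sum>e\<in>in_arcs (with_proj G) v. fm e y)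
    = (if v = s then u y else 0)"
proof -
  have out: "has_density (\<lambda>y. \<Sum>e\<in>out_arcs (with_proj G) v. cum_in e y) (\<lambda>y. \<Sum>e\<in>out_arcs (with_proj G) v. fp e y)"
    by (intro has_density_sum in_density) auto
  have inn: "has_density (\<lambda>y. \<Sum>e\<in>in_arcs (with_proj G) v. cum_out e y) (\<lambda>y. \<Sum>e\<in>in_arcs (with_proj G) v. fm e y)"
    by (intro has_density_sum out_density) auto
  \<comment> \<open>All arcs at \<open>v\<close> are read off at the same departure time, so
    conservation in departure time becomes conservation in clock time.\<close>
  have sums: "(\<Sum>e\<in>out_arcs (with_proj G) v. cum_in e y) = (\<Sum>e\<in>out_arcs (with_proj G) v. x e (departure v y))"
    "(\<Sum>e\<in>in_arcs (with_proj G) v. cum_out e y) = (\<Sum>e\<in>in_arcs (with_proj G) v. x e (departure v y))" for y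
    by (auto simp: cum_in_def cum_out_def intro!: sum.cong)
  show ?thesis
  proof (cases "v = s")
    case True
    have "AE y in lborel. (\<Sum>e\<in>out_arcs (with_proj G) v. fp e y) = (\<Sum>e\<in>in_arcs (with_proj G) v. fm e y) + u y"
    proof (rule density_AE_unique[OF out has_density_add[OF inn inflow_density]])
      have "(\<Sum>e\<in>out_arcs (with_proj G) v. cum_in e y) = (\<Sum>e\<in>in_arcs (with_proj G) v. cum_out e y) + W y" for y
        unfolding sums using conservation_source[of y] True by simp
      then show "(\<Sum>e\<in>out_arcs (with_proj G) v. cum_in e b) - (\<Sum>e\<in>out_arcs (with_proj G) v. cum_in e a)
        = (\<Sum>e\<in>in_arcs (with_proj G) v. cum_out e b) + W b - ((\<Sum>e\<in>in_arcs (with_proj G) v. cum_out e a) + W a)" for a b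
        by simp
    qed
    then show ?thesis
      by eventually_elim (use True in simp)
  next
    case False
    have "AE y in lborel. (\<Sum>e\<in>out_arcs (with_proj G) v. fp e y) = (\<Sum>e\<in>in_arcs (with_proj G) v. fm e y)"
      by (rule density_AE_unique[OF out inn]) (use v False conservation[of v] in \<open>simp add: sums\<close>)
    then show ?thesis
      by eventually_elim (use False in simp)
  qed
qed

lemma feasible: "feasible G \<nu> \<tau> s t u (fp, fm)"
  unfolding feasible_def flow_over_time_def
proof (intro conjI ballI AE_completion)
  fix e assume e: "e \<in> parcs G"
  show "fst (fp, fm) e \<in> F0" "snd (fp, fm) e \<in> F0"
    using has_density_in_F0[OF in_density[OF e]] has_density_in_F0[OF out_density[OF e]] cum_neg[OF e] by auto
next
  have "AE \<theta> in lborel. \<forall>e\<in>parcs G. fm e \<theta> \<le> \<nu> e"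
    using outflow_le_rate by (simp add: AE_finite_all)
  moreover have "AE \<theta> in lborel. \<forall>v\<in>pverts G - {t}. (\<Sum>e\<in>out_arcs (with_proj G) v. fp e \<theta>) -
      (\<Sum>e\<in>in_arcs (with_proj G) v. fm e \<theta>) = (if v = s then u \<theta> else 0)"
    using flow_conservation by (intro AE_finite_allI) auto
  ultimately show "AE \<theta> in lborel. (\<forall>e\<in>parcs G. snd (fp, fm) e \<theta> \<le> \<nu> e \<and> 0 \<le> queue_size \<tau> (fp, fm) e \<theta>) \<and>
        (\<forall>v\<in>pverts G - {t}. (\<Sum>e\<in>out_arcs (with_proj G) v. fst (fp, fm) e \<theta>) -
          (\<Sum>e\<in>in_arcs (with_proj G) v. snd (fp, fm) e \<theta>) = (if v = s then u \<theta> else 0))"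
    by eventually_elim (simp add: queue_size_nonneg)
qed

text \<open>The inactive times form an open set, so countably many rational intervals cover them. On
  each, \<open>x e\<close> is constant, hence so is \<open>cum_in e\<close> between the
  corresponding labels, and its density vanishes there up to a null set.\<close>

lemma inflow_vanishes_if_inactive:
  assumes e: "e \<in> parcs G"
  shows "AE \<xi> in lborel. \<xi> \<in> earliest_time G \<nu> \<tau> s (fp, fm) (fst e) ` (UNIV - active_times G \<nu> \<tau> s (fp, fm) e)
    \<longrightarrow> fp e \<xi> = 0"
proof -
  have v: "fst e \<in> pverts G" "snd e \<in> pverts G" using arc_ends_in_verts[OF e] by auto
  let ?I = "{(a, b) \<in> \<rat> \<times> \<rat>. a < b \<and> (\<forall>\<sigma>\<in>{a..b}. l (snd e) \<sigma> < q e \<sigma>)}"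
  have "countable ?I"
    by (rule countable_subset[of _ "\<rat> \<times> \<rat>"]) (auto simp: countable_rat)
  moreover have "AE \<xi> in lborel. l (fst e) (fst i) \<le> \<xi> \<and> \<xi> \<le> l (fst e) (snd i) \<longrightarrow> fp e \<xi> = 0"
    if i: "i \<in> ?I" for i
  proof (rule density_AE_eq_on[OF in_density[OF e] has_density_cmult[OF order_refl]])
    fix c d assume "l (fst e) (fst i) \<le> c" "c \<le> d" "d \<le> l (fst e) (snd i)"
    moreover have "x e (fst i) = x e (snd i)"
      using i by (intro constant_if_inactive[OF e]) auto
    ultimately show "cum_in e d - cum_in e c = 0 * d - 0 * c"
      using cum_mono(1)[OF e, of c d] cum_mono(1)[OF e, of "l (fst e) (fst i)" c]
        cum_mono(1)[OF e, of d "l (fst e) (snd i)"] by (simp add: cum_in_label[OF e])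
  qed
  ultimately have "AE \<xi> in lborel. \<forall>i\<in>?I. l (fst e) (fst i) \<le> \<xi> \<and> \<xi> \<le> l (fst e) (snd i) \<longrightarrow> fp e \<xi> = 0"
    by (subst AE_ball_countable) auto
  then show ?thesis
  proof eventually_elim
    case (elim \<xi>)
    show ?case
    proof
      assume "\<xi> \<in> earliest_time G \<nu> \<tau> s (fp, fm) (fst e) ` (UNIV - active_times G \<nu> \<tau> s (fp, fm) e)"
      then obtain \<theta> where \<theta>: "\<xi> = l (fst e) \<theta>" "\<not> q e \<theta> \<le> l (snd e) \<theta>"
        by (auto simp: active_times_def earliest_time_eq[OF v(1)] earliest_time_eq[OF v(2)] exit_time_label[OF e])
      have "open {\<sigma>. l (snd e) \<sigma> < q e \<sigma>}"
        using l_cont[OF v(2)] q_cont[OF e] by (intro open_Collect_less continuous_at_imp_continuous_on) auto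
      then obtain \<epsilon> where \<epsilon>: "0 < \<epsilon>" "\<And>\<sigma>. \<bar>\<sigma> - \<theta>\<bar> < \<epsilon> \<Longrightarrow> l (snd e) \<sigma> < q e \<sigma>"
        using \<theta>(2) unfolding open_real mem_Collect_eq not_le by blast
      obtain a where a: "a \<in> \<rat>" "\<theta> - \<epsilon> < a" "a < \<theta>"
        using Rats_dense_in_real[of "\<theta> - \<epsilon>" \<theta>] \<epsilon>(1) by auto
      obtain b where b: "b \<in> \<rat>" "\<theta> < b" "b < \<theta> + \<epsilon>"
        using Rats_dense_in_real[of \<theta> "\<theta> + \<epsilon>"] \<epsilon>(1) by auto
      have "(a, b) \<in> ?I"
        using a b \<epsilon>(2) by (auto simp: abs_less_iff)
      moreover have "l (fst e) a \<le> \<xi>" "\<xi> \<le> l (fst e) b"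
        using l_mono[OF v(1)] a b \<theta>(1) by auto
      ultimately show "fp e \<xi> = 0"
        using elim by auto
    qed
  qed
qed

text \<open>From entry at \<open>r\<close> until the queue found there is served, the outflow
  attains its Lipschitz bound, hence also on every subinterval. By continuity each time with a queue
  lies in such a period with rational \<open>r\<close>, so countably many null sets are
  discarded.\<close>

lemma capacity_if_queue:
  assumes e: "e \<in> parcs G"
  shows "AE y in lborel. 0 < queue_size \<tau> (fp, fm) e y \<longrightarrow> fm e (y + \<tau> e) = \<nu> e"
proof -
  let ?Z = "queue_size \<tau> (fp, fm) e" and ?D = "\<lambda>y. y + queue_size \<tau> (fp, fm) e y / \<nu> e"
  note pos = service_rate_pos[OF e]
  have "AE y in lborel. \<forall>r\<in>\<rat>. r \<le> y \<and> y \<le> ?D r \<longrightarrow> fm e (y + \<tau> e) = \<nu> e"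
  proof (subst AE_ball_countable[OF countable_rat], rule ballI)
    fix r :: real
    show "AE y in lborel. r \<le> y \<and> y \<le> ?D r \<longrightarrow> fm e (y + \<tau> e) = \<nu> e"
    proof (rule density_AE_eq_on[OF has_density_shift[OF out_density[OF e]] has_density_cmult])
      fix a b assume ab: "r \<le> a" "a \<le> b" "b \<le> ?D r"
      have "cum_out e (?D r + \<tau> e) = cum_in e r"
        using cum_out_exit[OF e, of "departure (fst e) r"] exit_time_eq[OF e, of r]
        by (simp add: exit_time_def cum_in_def algebra_simps)
      then have "cum_out e (?D r + \<tau> e) - cum_out e (r + \<tau> e) = \<nu> e * (?D r - r)"
        using pos by (simp add: queue_size_eq[OF e])
      moreover have "\<nu> e * (?D r - r) = \<nu> e * (?D r - b) + (\<nu> e * b - \<nu> e * a) + \<nu> e * (a - r)"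
        by (simp only: right_diff_distrib)
      ultimately show "cum_out e (b + \<tau> e) - cum_out e (a + \<tau> e) = \<nu> e * b - \<nu> e * a"
        using cum_out_lipschitz[OF e, of "r + \<tau> e" "a + \<tau> e"] cum_out_lipschitz[OF e, of "a + \<tau> e" "b + \<tau> e"]
          cum_out_lipschitz[OF e, of "b + \<tau> e" "?D r + \<tau> e"] ab
        unfolding add_diff_cancel_right right_diff_distrib[of _ b a, symmetric] by linarith
    qed (use pos in simp)
  qed
  then show ?thesis
  proof eventually_elim
    case (elim y)
    show ?case
    proof
      assume "0 < ?Z y"
      then have "y < ?D y" using pos by simp
      have "isCont ?D y" for y
        using has_density_continuous[OF in_density[OF e]]
          has_density_continuous[OF has_density_shift[OF out_density[OF e], of "\<tau> e"]] pos
        unfolding queue_size_eq[OF e] by (intro continuous_intros) auto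
      then have "open {r. y < ?D r}"
        by (intro open_Collect_less continuous_at_imp_continuous_on) auto
      then obtain \<epsilon> where \<epsilon>: "0 < \<epsilon>" "\<And>r. \<bar>r - y\<bar> < \<epsilon> \<Longrightarrow> y < ?D r"
        using \<open>y < ?D y\<close> unfolding open_real by blast
      obtain r where "r \<in> \<rat>" "y - \<epsilon> < r" "r < y"
        using Rats_dense_in_real[of "y - \<epsilon>" y] \<epsilon>(1) by auto
      then show "fm e (y + \<tau> e) = \<nu> e"
        using bspec[OF elim, of r] \<epsilon>(2)[of r] by simp
    qed
  qed
qed

text \<open>\<open>D\<close> is the exit time without the travel time, and its density is
  \<open>1 + (fp e y - fm e (y + \<tau> e)) / \<nu> e\<close> up to a null set. The queue is empty
  exactly at the fixed points of \<open>D\<close>, where this density is almost everywhere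
  one.\<close>

lemma outflow_eq_inflow_if_no_queue:
  assumes e: "e \<in> parcs G"
  shows "AE y in lborel. queue_size \<tau> (fp, fm) e y = 0 \<longrightarrow> fm e (y + \<tau> e) = fp e y"
proof -
  let ?Z = "queue_size \<tau> (fp, fm) e"
  define D where "D y = y + ?Z y / \<nu> e" for y
  note pos = service_rate_pos[OF e]
  note shifted = has_density_shift[OF out_density[OF e], of "\<tau> e"]
  have id: "has_density (\<lambda>y. 1 * y) (\<lambda>_. 1)" by (rule has_density_cmult) simp
  have sum: "D y + 1 / \<nu> e * cum_out e (y + \<tau> e) = 1 * y + 1 / \<nu> e * cum_in e y" for y
    by (simp add: D_def queue_size_eq[OF e] diff_divide_distrib)
  have in_scaled: "has_density (\<lambda>y. 1 * y + 1 / \<nu> e * cum_in e y) (\<lambda>y. 1 + 1 / \<nu> e * fp e y)"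
    using pos by (intro has_density_add id has_density_scale in_density[OF e]) simp
  have out_scaled: "has_density (\<lambda>y. 1 / \<nu> e * cum_out e (y + \<tau> e)) (\<lambda>y. 1 / \<nu> e * fm e (y + \<tau> e))"
    using pos by (intro has_density_scale shifted) simp
  have D_exit: "D y = exit_time \<nu> \<tau> (fp, fm) e y - \<tau> e" for y
    by (simp add: D_def exit_time_def)
  obtain d where d: "has_density D d"
  proof (rule mono_density_exists[OF in_scaled])
    show "mono D"
      unfolding mono_def D_exit exit_time_eq[OF e]
      using q_mono[OF e] departure_mono arc_ends_in_verts[OF e] by (simp)
    fix a b :: real assume "a \<le> b"
    have "1 / \<nu> e * cum_out e (a + \<tau> e) \<le> 1 / \<nu> e * cum_out e (b + \<tau> e)"
      using \<open>a \<le> b\<close> pos cum_mono(2)[OF e] by (intro mult_left_mono) auto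
    then show "D b - D a \<le> 1 * b + 1 / \<nu> e * cum_in e b - (1 * a + 1 / \<nu> e * cum_in e a)"
      unfolding sum[symmetric] by linarith
  qed
  have "AE y in lborel. d y + 1 / \<nu> e * fm e (y + \<tau> e) = 1 + 1 / \<nu> e * fp e y"
    by (rule density_AE_unique[OF has_density_add[OF d out_scaled] in_scaled]) (simp only: sum)
  moreover have "AE y in lborel. D y = y \<longrightarrow> d y = 1"
  proof (rule density_one_on_fixed_points[OF d])
    show "y \<le> D y" for y
      using queue_size_nonneg[OF e, of y] pos by (simp add: D_def)
    \<comment> \<open>Up to \<open>- \<tau> e\<close> both the cumulative inflow and the shifted
      cumulative outflow are zero.\<close>
    show "D y = y" if "y \<le> - \<tau> e" for y
      using that cum_neg[OF e] travel_time_pos[OF e] by (simp add: D_def queue_size_eq[OF e])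
  qed
  ultimately show ?thesis
    by eventually_elim (use pos in \<open>auto simp: D_def\<close>)
qed

lemma operates_at_capacity: "operates_at_capacity G \<nu> \<tau> (fp, fm)"
  unfolding operates_at_capacity_def
proof (intro ballI AE_completion)
  fix e assume e: "e \<in> parcs G"
  have "AE y in lborel. fm e (y + \<tau> e) \<le> \<nu> e"
  proof (rule density_AE_le[OF has_density_shift[OF out_density[OF e]] has_density_cmult])
    fix a b :: real assume "a \<le> b"
    then show "cum_out e (b + \<tau> e) - cum_out e (a + \<tau> e) \<le> \<nu> e * b - \<nu> e * a"
      using cum_out_lipschitz[OF e, of "a + \<tau> e" "b + \<tau> e"] by (simp add: right_diff_distrib)
  qed (use service_rate_pos[OF e] in simp)
  with capacity_if_queue[OF e] outflow_eq_inflow_if_no_queue[OF e]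
  show "AE y in lborel. snd (fp, fm) e (y + \<tau> e) =
      (if 0 < queue_size \<tau> (fp, fm) e y then \<nu> e else min (fst (fp, fm) e y) (\<nu> e))"
  proof eventually_elim
    case (elim y)
    then show ?case using queue_size_nonneg[OF e, of y] by auto
  qed
qed

lemma dynamic_equilibrium: "dynamic_equilibrium G \<nu> \<tau> s t u (fp, fm)"
  unfolding dynamic_equilibrium_def
  using feasible operates_at_capacity inflow_vanishes_if_inactive by (auto intro: AE_completion)

end

section \<open>Choice of the densities and reduction of the given inflow rate to a Borel one\<close>

lemma (in cumulative_inflow) dynamic_equilibrium_exists:
  assumes u: "has_density W u"
  shows "\<exists>f. dynamic_equilibrium G \<nu> \<tau> s t u f"
proof -
  obtain l q x where "approx_solution G \<nu> s t \<tau> W 0 l q x"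
    using exact_solution_exists by blast
  then interpret exact_solution G \<nu> s t \<tau> W l q x
    by (simp add: exact_solution_def)
  have rate: "0 \<le> (\<Sum>e\<in>parcs G. \<nu> e)"
    using service_rate_pos by (intro sum_nonneg) (auto simp: less_imp_le)
  have "\<exists>f. has_density (cum_in e) f" if e: "e \<in> parcs G" for e
  proof -
    have "mono (cum_in e)"
      using cum_mono(1)[OF e] by (rule monoI)
    then show ?thesis
      using mono_density_exists[OF has_density_add[OF u has_density_cmult[OF rate]] _ cum_in_growth[OF e]]
      by blast
  qed
  then obtain fp where fp: "\<And>e. e \<in> parcs G \<Longrightarrow> has_density (cum_in e) (fp e)"
    by metis
  have "\<exists>f. has_density (cum_out e) f" if e: "e \<in> parcs G" for e
  proof (rule mono_density_exists[OF has_density_cmult])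
    show "0 \<le> \<nu> e"
      using service_rate_pos[OF e] by simp
    show "mono (cum_out e)"
      using cum_mono(2)[OF e] by (rule monoI)
    show "cum_out e b - cum_out e a \<le> \<nu> e * b - \<nu> e * a" if "a \<le> b" for a b
      using cum_out_lipschitz[OF e that] by (simp add: right_diff_distrib)
  qed blast
  then obtain fm where fm: "\<And>e. e \<in> parcs G \<Longrightarrow> has_density (cum_out e) (fm e)"
    by metis
  interpret exact_solution_density G \<nu> s t \<tau> W l q x u fp fm
    by unfold_locales (use u fp fm in auto)
  show ?thesis
    using dynamic_equilibrium by blast
qed

lemma dynamic_equilibrium_cong_AE:
  assumes f: "dynamic_equilibrium G \<nu> \<tau> s t u f" and eq: "AE \<theta> in lebesgue. u \<theta> = u' \<theta>"
  shows "dynamic_equilibrium G \<nu> \<tau> s t u' f"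
proof -
  have "feasible G \<nu> \<tau> s t u f"
    using f by (simp add: dynamic_equilibrium_def)
  then have flow: "flow_over_time G f" and ae: "AE \<theta> in lebesgue.
        (\<forall>e\<in>parcs G. snd f e \<theta> \<le> \<nu> e \<and> 0 \<le> queue_size \<tau> f e \<theta>) \<and>
        (\<forall>v\<in>pverts G - {t}.
           (\<Sum>e\<in>out_arcs (with_proj G) v. fst f e \<theta>) - (\<Sum>e\<in>in_arcs (with_proj G) v. snd f e \<theta>)
             = (if v = s then u \<theta> else 0))"
    by (auto simp: feasible_def)
  have "feasible G \<nu> \<tau> s t u' f"
    unfolding feasible_def using ae eq by (intro conjI flow, eventually_elim) simp
  then show ?thesis
    using f by (simp add: dynamic_equilibrium_def)
qed

text \<open>The interval has finite length, so \<open>1 + \<bar>u x\<bar> powr p\<close> is an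
  integrable majorant.\<close>

lemma integrable_if_Lp_on:
  assumes u: "u \<in> Lp_on p {a<..<b}" and p: "1 < p"
  shows "set_integrable lebesgue {a<..<b} u"
proof -
  have "emeasure lebesgue {a<..<b} < \<infinity>"
    by (cases "a \<le> b") auto
  then have "set_integrable lebesgue {a<..<b} (\<lambda>x. 1 + \<bar>u x\<bar> powr p)"
    using u by (intro set_integral_add) (auto simp: Lp_on_def set_integrable_def intro: integrable_real_indicator)
  moreover have "\<bar>y\<bar> \<le> 1 + \<bar>y\<bar> powr p" for y :: real
  proof (cases "\<bar>y\<bar> \<le> 1")
    case False
    then have "\<bar>y\<bar> powr 1 \<le> \<bar>y\<bar> powr p" using p by (intro powr_mono) auto
    then show ?thesis using False by simp
  qed (simp add: add_increasing2)
  ultimately show ?thesis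
    using u unfolding set_integrable_def Lp_on_def set_borel_measurable_def
    by (elim Bochner_Integration.integrable_bound) (auto simp: indicator_def)
qed

text \<open>The given rate is only Lebesgue measurable and nonnegative almost everywhere. A Borel
  representative, cut off below zero and outside the interval, meets the pointwise demands of
  \<open>has_density\<close>.\<close>

lemma density_if_integrable_on_interval:
  assumes u: "set_integrable lebesgue {0<..<T} u" and nonneg: "AE \<theta> in lebesgue. \<theta> \<in> {0<..<T} \<longrightarrow> 0 \<le> u \<theta>"
  obtains W u' where "has_density W u'" "\<And>x. x \<le> 0 \<Longrightarrow> W x = 0"
    "AE \<theta> in lebesgue. u' \<theta> = (if \<theta> \<in> {0<..<T} then u \<theta> else 0)"
proof -
  define h where "h x = indicator {0<..<T} x *\<^sub>R u x" for x
  have h: "integrable lebesgue h"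
    using u by (simp add: h_def[abs_def] set_integrable_def)
  then obtain h' where h': "h' \<in> borel_measurable lborel" "AE x in lborel. h x = h' x"
    using completion_ex_borel_measurable_real[of h lborel] by auto
  define u' where "u' x = indicator {0<..<T} x * max 0 (h' x)" for x
  have u'_meas: "u' \<in> borel_measurable borel"
    unfolding u'_def[abs_def] using h'(1) by measurable
  have "AE x in lebesgue. h x = h' x"
    using h'(2) by (rule AE_completion)
  with nonneg have u'_eq: "AE x in lebesgue. u' x = h x"
    by eventually_elim (auto simp: u'_def h_def indicator_def)
  have int: "u' absolutely_integrable_on {a..b}" for a b
  proof -
    have "integrable lebesgue u'"
      using u'_eq u'_meas h by (subst integrable_cong_AE[of _ _ h]) (auto simp: measurable_completion)
    then have "u' absolutely_integrable_on UNIV"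
      by (simp add: set_integrable_def)
    then show ?thesis
      by (rule set_integrable_subset) auto
  qed
  then have int': "u' integrable_on {a..b}" for a b
    by (rule set_lebesgue_integral_eq_integral(1))
  \<comment> \<open>For negative \<open>x\<close> the interval is empty, which makes
    \<open>W\<close> vanish there.\<close>
  define W where "W x = integral {0..x} u'" for x
  have zero: "integral {a..b} u' = 0" if "b \<le> 0" for a b
  proof -
    have "integral {a..b} u' = integral {a..b} (\<lambda>_. 0)"
      using that by (intro Henstock_Kurzweil_Integration.integral_cong) (auto simp: u'_def)
    then show ?thesis by simp
  qed
  have W_neg: "W x = 0" if "x \<le> 0" for x
    using zero[OF that] by (simp add: W_def)
  have "(u' has_integral (W b - W a)) {a..b}" if ab: "a \<le> b" for a b
  proof -
    have "integral {a..b} u' = W b - W a"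
    proof (cases "0 \<le> a")
      case True
      then show ?thesis
        using Henstock_Kurzweil_Integration.integral_combine[OF True ab int'] by (simp add: W_def)
    next
      case False
      show ?thesis
      proof (cases "0 \<le> b")
        case True
        then show ?thesis
          using Henstock_Kurzweil_Integration.integral_combine[of a 0 b u', OF _ True int'] False zero[of 0 a] W_neg[of a]
          by (simp add: W_def)
      qed (use False zero[of b a] W_neg in simp)
    qed
    then show ?thesis
      using int'[of a b] by (metis integrable_integral)
  qed
  then have "has_density W u'"
    using u'_meas by (auto simp: has_density_def u'_def)
  moreover have "AE \<theta> in lebesgue. u' \<theta> = (if \<theta> \<in> {0<..<T} then u \<theta> else 0)"
    using u'_eq by eventually_elim (simp add: h_def indicator_def)
  ultimately show ?thesis
    using W_neg that by blast
qed

theorem theorem20: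
  fixes G :: "'v pair_pre_digraph"
    and \<nu> \<tau> :: "'v \<times> 'v \<Rightarrow> real"
    and s t :: 'v
    and u :: "real \<Rightarrow> real"
    and T p :: real
  assumes "fluid_network G \<nu> s t"
    and "\<And>e. e \<in> parcs G \<Longrightarrow> 0 < \<tau> e"
    and "0 < T"
    and "1 < p"
    and "u \<in> Lp_on p {0<..<T}"
    and "AE \<theta> in lebesgue. \<theta> \<in> {0<..<T} \<longrightarrow> 0 \<le> u \<theta>"
  shows "\<exists>f. dynamic_equilibrium G \<nu> \<tau> s t (\<lambda>\<theta>. if \<theta> \<in> {0..T} then u \<theta> else 0) f"
proof -
  have "set_integrable lebesgue {0<..<T} u"
    using assms(5,4) by (rule integrable_if_Lp_on)
  then obtain W u' where W: "has_density W u'" "\<And>x. x \<le> 0 \<Longrightarrow> W x = 0"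
    and u': "AE \<theta> in lebesgue. u' \<theta> = (if \<theta> \<in> {0<..<T} then u \<theta> else 0)"
    by (rule density_if_integrable_on_interval[OF _ assms(6)]) (rule that)
  interpret fluid_network G \<nu> s t
    by fact
  interpret cumulative_inflow G \<nu> s t \<tau> W
    using assms(2) W has_density_mono has_density_continuous by unfold_locales auto
  obtain f where f: "dynamic_equilibrium G \<nu> \<tau> s t u' f"
    using dynamic_equilibrium_exists[OF W(1)] by blast
  \<comment> \<open>The integrability assumption concerns the open interval, the inflow rate the
    closed one; the two endpoints form a null set.\<close>
  have "AE \<theta> in lborel. \<theta> \<noteq> 0 \<and> \<theta> \<noteq> T"
    by (intro AE_conjI AE_lborel_singleton)
  then have "AE \<theta> in lebesgue. \<theta> \<noteq> 0 \<and> \<theta> \<noteq> T"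
    by (rule AE_completion)
  with u' have "AE \<theta> in lebesgue. u' \<theta> = (if \<theta> \<in> {0..T} then u \<theta> else 0)"
    by eventually_elim auto
  with f show ?thesis
    by (intro exI[of _ f]) (rule dynamic_equilibrium_cong_AE)
qed

end
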